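(* In the setting described in the context (spaces $V\hookrightarrow H\hookrightarrow V'$, $\alpha\in[0,1[$, damping $\gamma$, operator $A$, nonlinearity $f=\nabla F$, convex function $\Phi$ with $\arg\min\Phi\neq\emptyset$, and source $g\in L^1(\mathbb{R}^+,H)$), assume that the function $\Phi$ is even (i.e. $\Phi(-v)=\Phi(v)$ for all $v\in V$), and that $$\int_0^{+\infty}(1+t)^{\alpha}|g(t)|\,dt<\infty\quad\text{and}\quad \int_0^{+\infty}(1+t)^{2\alpha+1}|g(t)|^2\,dt<\infty .$$ Let $u\in W^{2,1}_{loc}(\mathbb{R}^+,H)\cap W^{1,1}_{loc}(\mathbb{R}^+,V)$ be a solution of $$u''(t)+\gamma(t)u'(t)+Au(t)+f(u(t))=g(t),\quad t\ge 0.$$ Then there exists $u_\infty\in\arg\min\Phi$ such that $u(t)\to u_\infty$ strongly in $V$ as $t\to+\infty$.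
   Context: Setting. $\mathbb{R}^+=[0,+\infty)$. $H$ is a real Hilbert space with inner product $\langle\cdot,\cdot\rangle$ and norm $|\cdot|$. $V$ is another Hilbert space, with norm $\|\cdot\|_V$, continuously and densely embedded in $H$; $V'$ is the dual of $V$. Identifying $H$ with its dual, $V\hookrightarrow H\hookrightarrow V'$, and $\langle v,w\rangle_{V',V}=\langle v,w\rangle$ for all $(v,w)\in H\times V$. Damping: $\alpha\in[0,1[$, and $\gamma\in W^{1,1}_{loc}(\mathbb{R}^+,\mathbb{R}^+)$ is such that there exist $K>0$ and $t_0\ge0$ with $\gamma(t)\ge \frac{K}{(1+t)^\alpha}$ for all $t\ge t_0$, and $\big((1+t)^\alpha\gamma(t)\big)'\le 0$ for a.e. $t\ge t_0$. Operator: $A:V\to V'$ is linear and continuous; the bilinear form $a(v,w)=\langle Av,w\rangle_{V',V}$ on $V\times V$ is symmetric, positive ($a(v,v)\ge0$ for all $v\in V$), and there exist $\lambda\ge0$, $\mu>0$ with $a(v,v)+\lambda|v|^2\ge\mu\|v\|_V^2$ for all $v\in V$. Nonlinearity: $f:V\to V'$ is continuous and there is a $C^1$ convex function $F:V\to\mathbb{R}$ with $F'(u)(v)=\langle f(u),v\rangle_{V',V}$ for all $u,v\in V$. Potential: $\Phi:V\to\mathbb{R}$, $\Phi(v)=\frac12 a(v,v)+F(v)$; it is a $C^1$ convex function with $\nabla\Phi(v)=Av+f(v)$. The set $\arg\min\Phi=\{v\in V:\Phi(v)=\min_V\Phi\}=\{v\in V: Av+f(v)=0\}$ is assumed nonempty.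 Source: $g\in L^1(\mathbb{R}^+,H)$. The equation is understood to hold for almost every $t\ge0$. *)

theory Defs
  imports "HOL-Analysis.Analysis"
begin

text \<open>
  The library's \<^const>\<open>has_bochner_integral\<close> needs a second countable codomain.  Since the Hilbert
  spaces considered here need not be separable, its definition is repeated without that sort
  constraint.  Even then, approximability by simple functions in the sense of the third condition
  forces \<open>f\<close> to be almost everywhere separably valued, so over \<^const>\<open>lebesgue\<close> this is the usual
  Bochner integral of strongly measurable functions.
\<close>

definition has_strong_integral ::
    "'a measure \<Rightarrow> ('a \<Rightarrow> 'b::real_normed_vector) \<Rightarrow> 'b \<Rightarrow> bool" where
  "has_strong_integral M f x \<longleftrightarrow>
     f \<in> borel_measurable M \<and>
     (\<exists>s. (\<forall>i. Bochner_Integration.simple_bochner_integrable M (s i)) \<and>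
          ((\<lambda>i. \<integral>\<^sup>+y. ennreal (norm (f y - s i y)) \<partial>M) \<longlonglongrightarrow> 0) \<and>
          ((\<lambda>i. Bochner_Integration.simple_bochner_integral M (s i)) \<longlonglongrightarrow> x))"

lemma has_strong_integral_iff_has_bochner_integral:
  fixes f :: "'a \<Rightarrow> 'b::{real_normed_vector, second_countable_topology}"
  shows "has_strong_integral M f x \<longleftrightarrow> has_bochner_integral M f x"
  unfolding has_strong_integral_def has_bochner_integral.simps by blast

definition strongly_integrable :: "'a measure \<Rightarrow> ('a \<Rightarrow> 'b::real_normed_vector) \<Rightarrow> bool" where
  "strongly_integrable M f \<longleftrightarrow> (\<exists>x. has_strong_integral M f x)"

text \<open>
  \<open>has_weak_derivative u u'\<close>: \<open>u\<close> is (the continuous representative of) an element of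
  \<open>W\<^sup>1\<^sup>,\<^sup>1([0,T],X)\<close> for every \<open>T > 0\<close>, with weak derivative \<open>u'\<close>, i.e. \<open>u'\<close> is Bochner integrable on every
  \<open>[0,t]\<close> and \<open>u(t) = u(0) + \<integral>\<^sub>0\<^sup>t u'(s) ds\<close>.  Values at negative times are irrelevant.
\<close>

definition has_weak_derivative ::
    "(real \<Rightarrow> 'b::real_normed_vector) \<Rightarrow> (real \<Rightarrow> 'b) \<Rightarrow> bool" where
  "has_weak_derivative u u' \<longleftrightarrow>
     (\<forall>t\<ge>0. has_strong_integral (lebesgue_on {0..t}) u' (u t - u 0))"

definition W11_loc :: "(real \<Rightarrow> 'b::real_normed_vector) \<Rightarrow> bool" where
  "W11_loc u \<longleftrightarrow> (\<exists>u'. has_weak_derivative u u')"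

text \<open>
  \<open>V'\<close> is \<^typ>\<open>'v \<Rightarrow>\<^sub>L real\<close>, and \<open>j\<close> is the embedding of \<open>V\<close> into \<open>H\<close>.  The embedding of \<open>H\<close> into
  \<open>V'\<close> obtained by identifying \<open>H\<close> with its dual sends \<open>h\<close> to \<open>v \<mapsto> \<langle>h, j v\<rangle>\<close>.
\<close>

definition dual_embed ::
    "('v::real_normed_vector \<Rightarrow>\<^sub>L 'h::real_inner) \<Rightarrow> 'h \<Rightarrow> ('v \<Rightarrow>\<^sub>L real)" where
  "dual_embed j h = blinfun_inner_right h o\<^sub>L j"

lemma dual_embed_apply: "blinfun_apply (dual_embed j h) v = inner h (blinfun_apply j v)"
  by (simp add: dual_embed_def)

definition potential ::
    "('v::real_normed_vector \<Rightarrow>\<^sub>L 'v \<Rightarrow>\<^sub>L real) \<Rightarrow> ('v \<Rightarrow> real) \<Rightarrow> 'v \<Rightarrow> real" where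
  "potential A F v = 1/2 * blinfun_apply (blinfun_apply A v) v + F v"

definition arg_min_set :: "('v \<Rightarrow> real) \<Rightarrow> 'v set" where
  "arg_min_set \<Phi> = {v. is_arg_min \<Phi> (\<lambda>_. True) v}"

end

theory Submission
  imports Defs
begin

text \<open>
  By evenness \<open>0\<close> minimizes the potential \<open>\<Phi>\<close>. Let \<open>E = |u'|\<^sup>2/2 + \<Phi>(u) - \<Phi>(0)\<close> and \<open>p = |u|\<^sup>2/2\<close>. The convexity
  inequality \<open>\<langle>\<nabla>\<Phi>(u), u\<rangle> \<ge> \<Phi>(u) - \<Phi>(0)\<close> makes
  \<open>(1+t)\<^bsup>1+\<alpha>\<^esup> E / 4 + (1+t)\<^bsup>\<alpha>\<^esup> p' + ((1+t)\<^bsup>\<alpha>\<^esup> \<gamma> - \<alpha> (1+t)\<^bsup>\<alpha>-1\<^esup>) p\<close> a Lyapunov function up to integrable errors,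
  whence \<open>u\<close> is bounded in \<open>H\<close>, the integrals of \<open>(1+t)\<^bsup>\<alpha>\<^esup> E\<close> and \<open>(1+t) |u'|\<^sup>2\<close> converge, and \<open>(1+t)\<^bsup>1+\<alpha>\<^esup> E \<longrightarrow> 0\<close>.
  For fixed \<open>r\<close>, evenness and convexity give \<open>\<langle>\<nabla>\<Phi>(u(t)), u(t) + u(r)\<rangle> \<ge> \<Phi>(u(t)) - \<Phi>(u(r))\<close>, which bounds
  \<open>q'' + \<gamma> q'\<close> for \<open>q(t) = |u(t)|\<^sup>2 - |u(r)|\<^sup>2 - |u(t) - u(r)|\<^sup>2/2\<close> by the same integrable quantities. As
  \<open>q(r) = 0\<close>, it follows that \<open>|u(r)|\<^sup>2 - |u(t)|\<^sup>2 + |u(t) - u(r)|\<^sup>2/2\<close> is small uniformly in \<open>r \<ge> t\<close>, so \<open>u\<close> is Cauchy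
  in \<open>H\<close>. Since \<open>\<Phi>(u(t)) \<longrightarrow> \<Phi>(0)\<close>, the parallelogram identity for \<open>a\<close> and coercivity make it Cauchy in \<open>V\<close>.

  The derivatives are classical almost everywhere: almost every point is a Lebesgue point of a
  strongly integrable function, by the usual argument with the maximal function. The differential
  inequalities are integrated for functions \<open>Z\<close> with \<open>|Z(t) - Z(s)|\<close> bounded by the integral of some \<open>m\<close> over \<open>[s,t]\<close>.
\<close>

section \<open>Lebesgue points of strongly integrable functions\<close>

text \<open>Weak-type bound for the maximal function with radii up to 1. Among the balls whose
  integral of \<open>m\<close> exceeds \<open>lam * r\<close>, Vitali selects disjoint ones whose
  fivefold enlargements cover all of them. An enlarged ball has length \<open>10 * snd i\<close>, at
  most \<open>10 / lam\<close> times the integral of \<open>m\<close> over the original ball, and by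
  disjointness these integrals add up to no more than the total.\<close>

lemma maximal_inequality:
  fixes m :: "real \<Rightarrow> real"
  assumes m: "integrable lebesgue m" and m_nonneg: "\<And>x. 0 \<le> m x" and lam: "lam > 0"
  obtains S where "S \<in> lmeasurable" "measure lebesgue S \<le> 10 / lam * (LINT x|lebesgue. m x)"
    "\<And>t r. t \<notin> S \<Longrightarrow> 0 < r \<Longrightarrow> r \<le> 1 \<Longrightarrow> (LINT x:ball t r|lebesgue. m x) \<le> lam * r"
proof -
  define K where "K = {(t, r). 0 < r \<and> r \<le> 1 \<and> lam * r < (LINT x:ball t r|lebesgue. m x)}"
  have K: "\<And>i. i \<in> K \<Longrightarrow> 0 < snd i \<and> snd i \<le> 1"
    by (auto simp: K_def)
  obtain C where C: "countable C" "C \<subseteq> K"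
    "pairwise (\<lambda>i j. disjnt (ball (fst i) (snd i)) (ball (fst j) (snd j))) C"
    "(\<Union>i\<in>K. ball (fst i) (snd i)) \<subseteq> (\<Union>i\<in>C. ball (fst i) (5 * snd i))"
    by (rule Vitali_covering_lemma_balls[OF order_refl K, where a = fst])
  \<comment> \<open>Finite subfamilies suffice: measurability and the bound pass to the countable
    union through \<open>fmeasurable_UN_bound\<close> and \<open>measure_UN_bound\<close>.\<close>
  have bound: "measure lebesgue (\<Union>i\<in>I. ball (fst i) (5 * snd i)) \<le> 10 / lam * (LINT x|lebesgue. m x)"
    if I: "I \<subseteq> C" "finite I" for I
  proof -
    have si: "set_integrable lebesgue (ball t r) m" for t r
      unfolding set_integrable_def by (rule integrable_mult_indicator) (use m in auto)
    have pos: "0 < snd i" "lam * snd i < (LINT x:ball (fst i) (snd i)|lebesgue. m x)" if "i \<in> I" for i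
      using that I C(2) by (auto simp: K_def)
    have disj: "disjoint_family_on (\<lambda>i. ball (fst i) (snd i)) I"
      using I C(3) unfolding disjoint_family_on_def pairwise_def disjnt_def by blast
    have "measure lebesgue (\<Union>i\<in>I. ball (fst i) (5 * snd i)) \<le> (\<Sum>i\<in>I. measure lebesgue (ball (fst i) (5 * snd i)))"
      by (rule measure_UNION_le) (use I in auto)
    also have "\<dots> = (\<Sum>i\<in>I. 10 * snd i)"
    proof (intro sum.cong refl)
      fix i assume "i \<in> I"
      then have "fst i - 5 * snd i \<le> fst i + 5 * snd i" using pos(1)[of i] by simp
      then show "measure lebesgue (ball (fst i) (5 * snd i)) = 10 * snd i"
        by (simp add: ball_eq_greaterThanLessThan)
    qed
    also have "\<dots> \<le> (\<Sum>i\<in>I. 10 / lam * (LINT x:ball (fst i) (snd i)|lebesgue. m x))"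
      using pos lam by (intro sum_mono) (force simp: field_simps)
    also have "\<dots> = 10 / lam * (LINT x|lebesgue. (\<Sum>i\<in>I. indicator (ball (fst i) (snd i)) x *\<^sub>R m x))"
      using si by (simp add: sum_distrib_left set_lebesgue_integral_def set_integrable_def
          Bochner_Integration.integral_sum)
    also have "\<dots> \<le> 10 / lam * (LINT x|lebesgue. m x)"
    proof (intro mult_left_mono integral_mono m)
      show "integrable lebesgue (\<lambda>x. \<Sum>i\<in>I. indicator (ball (fst i) (snd i)) x *\<^sub>R m x)"
        using si by (auto simp: set_integrable_def)
      fix x
      have "(\<Sum>i\<in>I. indicator (ball (fst i) (snd i)) x *\<^sub>R m x)
            = indicator (\<Union>i\<in>I. ball (fst i) (snd i)) x * m x"
        using arg_cong[OF indicator_UN_disjoint[OF I(2) disj, of x], of "\<lambda>c. c * m x"]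
        by (simp add: sum_distrib_right)
      also have "\<dots> \<le> m x" using m_nonneg[of x] by (auto simp: indicator_def)
      finally show "(\<Sum>i\<in>I. indicator (ball (fst i) (snd i)) x *\<^sub>R m x) \<le> m x" .
    qed (use lam in auto)
    finally show ?thesis .
  qed
  have nonneg: "0 \<le> 10 / lam * (LINT x|lebesgue. m x)"
    using lam m_nonneg by simp
  show thesis
  proof
    show "(\<Union>i\<in>C. ball (fst i) (5 * snd i)) \<in> lmeasurable"
      using fmeasurable_UN_bound[OF C(1) _ bound] by auto
    show "measure lebesgue (\<Union>i\<in>C. ball (fst i) (5 * snd i)) \<le> 10 / lam * (LINT x|lebesgue. m x)"
      using measure_UN_bound[OF C(1) _ bound] by auto
    fix t r :: real
    assume t: "t \<notin> (\<Union>i\<in>C. ball (fst i) (5 * snd i))" and r: "0 < r" "r \<le> 1"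
    have "(t, r) \<notin> K"
    proof
      assume "(t, r) \<in> K"
      with r have "t \<in> (\<Union>i\<in>K. ball (fst i) (snd i))" by force
      with t C(4) show False by blast
    qed
    then show "(LINT x:ball t r|lebesgue. m x) \<le> lam * r" using r by (auto simp: K_def)
  qed
qed

section \<open>Strong integrals: measurability, norms and linear images\<close>

text \<open>In a nonseparable space a difference of Borel functions need not be Borel. Since
  \<open>s\<close> has finitely many values, the function is glued from the compositions
  \<open>norm (f x - c)\<close> of \<open>f\<close> with continuous maps, one for each value
  \<open>c\<close>.\<close>

lemma borel_measurable_norm_diff_simple:
  fixes f s :: "'a \<Rightarrow> 'b::real_normed_vector"
  assumes f: "f \<in> borel_measurable M" and s: "simple_function M s"
  shows "(\<lambda>x. norm (f x - s x)) \<in> borel_measurable M"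
proof (rule measurable_compose_countable'[where f = "\<lambda>c x. norm (f x - c)" and g = s and I = "s ` space M"])
  show "(\<lambda>x. norm (f x - c)) \<in> borel_measurable M" for c
    by (rule borel_measurable_continuous_on[OF _ f]) (intro continuous_intros)
  show "s \<in> M \<rightarrow>\<^sub>M count_space (s ` space M)"
    using s by (auto simp: measurable_def simple_function_def intro: countable_finite
        dest: finite_subset) (metis (no_types, lifting) measurable_sets[OF measurable_simple_function[OF s]] UNIV_I sets_count_space Pow_UNIV)
  show "countable (s ` space M)"
    using s by (simp add: simple_function_def countable_finite)
qed

text \<open>Some approximant has L1 distance below 1 from \<open>f\<close>, and simple integrable
  functions have integrable norm.\<close>

lemma has_strong_integral_norm_integrable:
  assumes "has_strong_integral M f x"
  shows "integrable M (\<lambda>t. norm (f t))"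
proof (rule integrableI_bounded)
  from assms obtain s where f: "f \<in> borel_measurable M"
    and s: "\<And>i. Bochner_Integration.simple_bochner_integrable M (s i)"
    and lim: "(\<lambda>i. \<integral>\<^sup>+y. ennreal (norm (f y - s i y)) \<partial>M) \<longlonglongrightarrow> 0"
    by (auto simp: has_strong_integral_def)
  show "(\<lambda>t. norm (f t)) \<in> borel_measurable M"
    by (rule borel_measurable_continuous_on[OF _ f]) (intro continuous_intros)
  have "eventually (\<lambda>i. (\<integral>\<^sup>+y. ennreal (norm (f y - s i y)) \<partial>M) < 1) sequentially"
    using order_tendstoD(2)[OF lim, of 1] by simp
  then obtain i where i: "(\<integral>\<^sup>+y. ennreal (norm (f y - s i y)) \<partial>M) < 1"
    by (auto simp: eventually_sequentially)
  have si: "simple_function M (s i)"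
    using s[of i] by (auto elim: simple_bochner_integrable.cases)
  have "integrable M (\<lambda>y. norm (s i y))"
    using has_bochner_integral_simple_bochner_integrable[OF
        simple_bochner_integrable_compose2[where p = "\<lambda>a b. norm a", OF _ s[of i] s[of i]]]
    by (auto simp: has_bochner_integral_iff)
  then have fin: "(\<integral>\<^sup>+y. ennreal (norm (s i y)) \<partial>M) < \<infinity>"
    by (simp add: integrable_iff_bounded)
  have "(\<integral>\<^sup>+y. ennreal (norm (f y)) \<partial>M)
      \<le> (\<integral>\<^sup>+y. ennreal (norm (f y - s i y)) + ennreal (norm (s i y)) \<partial>M)"
    by (intro nn_integral_mono) (simp flip: ennreal_plus add: norm_triangle_sub add.commute)
  also have "\<dots> = (\<integral>\<^sup>+y. ennreal (norm (f y - s i y)) \<partial>M) + (\<integral>\<^sup>+y. ennreal (norm (s i y)) \<partial>M)"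
    using borel_measurable_norm_diff_simple[OF f si] \<open>integrable M (\<lambda>y. norm (s i y))\<close>
    by (intro nn_integral_add) auto
  also have "\<dots> < \<infinity>" using i fin by (metis ennreal_add_less_top ennreal_one_less_top infinity_ennreal_def less_trans)
  finally show "(\<integral>\<^sup>+y. ennreal (norm (norm (f y))) \<partial>M) < \<infinity>" by simp
qed

text \<open>The functions \<open>T (s i x)\<close> approximate \<open>T (f x)\<close> with the error
  enlarged by \<open>K\<close> at most. With \<open>T = inner y\<close> this turns vector integrals
  into real ones.\<close>

lemma has_strong_integral_bounded_linear:
  fixes T :: "'b::real_normed_vector \<Rightarrow> 'c::{real_normed_vector, second_countable_topology}"
  assumes "bounded_linear T" and "has_strong_integral M f x"
  shows "has_bochner_integral M (\<lambda>t. T (f t)) (T x)"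
proof -
  interpret T: bounded_linear T by fact
  from assms(2) obtain s where f: "f \<in> borel_measurable M"
    and s: "\<And>i. Bochner_Integration.simple_bochner_integrable M (s i)"
    and lim: "(\<lambda>i. \<integral>\<^sup>+y. ennreal (norm (f y - s i y)) \<partial>M) \<longlonglongrightarrow> 0"
    and int: "(\<lambda>i. Bochner_Integration.simple_bochner_integral M (s i)) \<longlonglongrightarrow> x"
    by (auto simp: has_strong_integral_def)
  obtain K where K: "K > 0" "\<And>x i. norm (T (f x) - T (s i x)) \<le> norm (f x - s i x) * K"
    using T.pos_bounded by (auto simp: T.diff[symmetric])
  show ?thesis
  proof
    show "(\<lambda>t. T (f t)) \<in> borel_measurable M"
      by (rule borel_measurable_continuous_on[OF _ f]) (intro T.continuous_on continuous_on_id)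
    show "Bochner_Integration.simple_bochner_integrable M (\<lambda>x. T (s i x))" for i
      using simple_bochner_integrable_compose2[where p = "\<lambda>a b. T a", OF _ s[of i] s[of i]]
      by (simp)
    show "(\<lambda>i. \<integral>\<^sup>+ x. norm (T (f x) - T (s i x)) \<partial>M) \<longlonglongrightarrow> 0" (is "?f \<longlonglongrightarrow> 0")
    proof (rule tendsto_sandwich)
      show "eventually (\<lambda>n. 0 \<le> ?f n) sequentially" "(\<lambda>_. 0) \<longlonglongrightarrow> 0"
        by auto
      show "eventually (\<lambda>i. ?f i \<le> K * (\<integral>\<^sup>+ x. norm (f x - s i x) \<partial>M)) sequentially"
      proof (intro always_eventually allI)
        fix i
        have "?f i \<le> (\<integral>\<^sup>+ x. ennreal K * norm (f x - s i x) \<partial>M)"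
          using K by (intro nn_integral_mono) (auto simp: ac_simps ennreal_mult[symmetric])
        also have "\<dots> = K * (\<integral>\<^sup>+ x. norm (f x - s i x) \<partial>M)"
          using K s[of i] f
          by (intro nn_integral_cmult measurable_compose[OF borel_measurable_norm_diff_simple])
             (auto elim: simple_bochner_integrable.cases)
        finally show "?f i \<le> K * (\<integral>\<^sup>+ x. norm (f x - s i x) \<partial>M)" .
      qed
      show "(\<lambda>i. K * (\<integral>\<^sup>+ x. norm (f x - s i x) \<partial>M)) \<longlonglongrightarrow> 0"
        using ennreal_tendsto_cmult[OF _ lim] by simp
    qed
    show "(\<lambda>i. Bochner_Integration.simple_bochner_integral M (\<lambda>x. T (s i x))) \<longlonglongrightarrow> T x"
      using s int by (auto intro!: T.tendsto simp: simple_bochner_integral_linear T.linear_axioms)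
  qed
qed

text \<open>A simple function jumps near \<open>t\<close> only inside the small sets \<open>U y - C y\<close> that separate an open superset
  of a level set from a closed subset.\<close>

lemma strongly_integrable_almost_continuous:
  fixes f :: "real \<Rightarrow> 'b::real_normed_vector"
  assumes f: "has_strong_integral (lebesgue_on S) f v" and S: "S \<in> sets lebesgue" and e: "e > 0"
  obtains m where "integrable lebesgue m" "\<And>x. 0 \<le> m x" "(LINT x|lebesgue. m x) < e"
    "\<And>t. t \<in> S \<Longrightarrow> eventually (\<lambda>x. x \<in> S \<longrightarrow> norm (f x - f t) \<le> m x + m t) (nhds t)"
proof -
  from f obtain s' where fm: "f \<in> borel_measurable (lebesgue_on S)"
    and s': "\<And>i. Bochner_Integration.simple_bochner_integrable (lebesgue_on S) (s' i)"
    and lim: "(\<lambda>i. \<integral>\<^sup>+y. ennreal (norm (f y - s' i y)) \<partial>(lebesgue_on S)) \<longlonglongrightarrow> 0"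
    by (auto simp: has_strong_integral_def)
  have "eventually (\<lambda>i. (\<integral>\<^sup>+y. ennreal (norm (f y - s' i y)) \<partial>(lebesgue_on S)) < ennreal (e/2)) sequentially"
    using order_tendstoD(2)[OF lim, of "ennreal (e/2)"] e by simp
  then obtain i where i: "(\<integral>\<^sup>+y. ennreal (norm (f y - s' i y)) \<partial>(lebesgue_on S)) < ennreal (e/2)"
    by (auto simp: eventually_sequentially)
  define s where "s = s' i"
  have s: "simple_function (lebesgue_on S) s"
    using s'[of i] by (auto elim: simple_bochner_integrable.cases simp: s_def)
  define R where "R = s ` S"
  have R: "finite R" using s by (simp add: R_def simple_function_def)
  define A where "A y = {x \<in> S. s x = y}" for y
  have A: "A y \<in> sets lebesgue" for y
  proof -
    have "s -` {y} \<inter> space (lebesgue_on S) \<in> sets (lebesgue_on S)"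
      using s by (rule simple_functionD)
    then show ?thesis using S by (auto simp: A_def sets_restrict_space_iff vimage_def Int_def conj_commute)
  qed
  \<comment> \<open>Chosen so that \<open>norm y\<close> times the measure
    \<open>2 * \<eta> y\<close> of a collar is at most \<open>e / (4 * (card R + 1))\<close>; the
    sum over \<open>R\<close> then stays below \<open>e / 4\<close>.\<close>
  define \<eta> where "\<eta> y = e / (8 * (norm y + 1) * (card R + 1))" for y :: 'b
  have \<eta>: "\<eta> y > 0" for y 
    unfolding \<eta>_def using e by (intro divide_pos_pos mult_pos_pos) (auto intro: add_nonneg_pos)
  have "\<exists>U C. open U \<and> closed C \<and> C \<subseteq> A y \<and> A y \<subseteq> U \<and> U - C \<in> lmeasurable \<and> measure lebesgue (U - C) \<le> 2 * \<eta> y" for y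
  proof -
    obtain U where U: "open U" "A y \<subseteq> U" "U - A y \<in> lmeasurable" "emeasure lebesgue (U - A y) < ennreal (\<eta> y)"
      using sets_lebesgue_outer_open[OF A \<eta>] by metis
    obtain C where C: "closed C" "C \<subseteq> A y" "A y - C \<in> lmeasurable" "emeasure lebesgue (A y - C) < ennreal (\<eta> y)"
      using sets_lebesgue_inner_closed[OF A \<eta>] by metis
    have eq: "U - C = (U - A y) \<union> (A y - C)" using U C by auto
    have "measure lebesgue (U - C) \<le> measure lebesgue (U - A y) + measure lebesgue (A y - C)"
      unfolding eq using U C by (intro measure_Un_le) auto
    also have "\<dots> \<le> \<eta> y + \<eta> y"
      using U(4) C(4) \<eta>[of y] 
      by (intro add_mono; simp add: measure_def enn2real_leI)
    finally show ?thesis using U C eq fmeasurable.Un[OF U(3) C(3)] by (intro exI[of _ U] exI[of _ C]) auto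
  qed
  then obtain U C where UC: "\<And>y. open (U y)" "\<And>y. closed (C y)" "\<And>y. C y \<subseteq> A y" "\<And>y. A y \<subseteq> U y"
     "\<And>y. U y - C y \<in> lmeasurable" "\<And>y. measure lebesgue (U y - C y) \<le> 2 * \<eta> y"
    by metis
  \<comment> \<open>\<open>n\<close> is the approximation error extended by 0 outside
    \<open>S\<close>; \<open>k\<close> charges \<open>norm y\<close> on each collar
    \<open>U y - C y\<close>. The majorant is \<open>n + k\<close>.\<close>
  define n where "n x = indicator S x * norm (f x - s x)" for x
  define k where "k x = (\<Sum>y\<in>R. norm y * indicator (U y - C y) x)" for x :: real
  have n_meas: "n \<in> borel_measurable lebesgue"
    using borel_measurable_norm_diff_simple[OF fm s] S
    by (simp add: n_def[abs_def] borel_measurable_restrict_space_iff mult.commute)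
  have "(\<integral>\<^sup>+x. ennreal (n x) \<partial>lebesgue) = (\<integral>\<^sup>+y. ennreal (norm (f y - s y)) \<partial>(lebesgue_on S))"
    using S by (subst nn_integral_restrict_space) (auto simp: n_def indicator_def intro!: nn_integral_cong)
  then have n_int: "(\<integral>\<^sup>+x. ennreal (n x) \<partial>lebesgue) < ennreal (e/2)" using i by (simp add: s_def)
  have n0: "0 \<le> n x" for x by (simp add: n_def)
  have n1: "integrable lebesgue n"
    using n_meas n_int n0 by (intro integrableI_bounded) (auto intro: less_trans)
  have n2: "(LINT x|lebesgue. n x) < e/2"
    using n_int nn_integral_eq_integral[OF n1] n0 e by (simp add: ennreal_less_iff)
  have k0: "0 \<le> k x" for x by (simp add: k_def sum_nonneg)
  have k1: "integrable lebesgue k"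
    unfolding k_def using UC(5)
    by (intro Bochner_Integration.integrable_sum integrable_mult_right) (simp add: lmeasurable_iff_integrable)
  have "(LINT x|lebesgue. k x) = (\<Sum>y\<in>R. norm y * measure lebesgue (U y - C y))"
    unfolding k_def using UC(5)
    by (subst Bochner_Integration.integral_sum) (auto simp: lmeasurable_iff_integrable)
  also have "\<dots> \<le> (\<Sum>y\<in>R. e / (4 * (card R + 1)))"
  proof (rule sum_mono)
    fix y
    have "norm y * measure lebesgue (U y - C y) \<le> (norm y + 1) * (2 * \<eta> y)"
      using UC(6)[of y] by (intro mult_mono) auto
    also have "\<dots> = e / (4 * (card R + 1))"
    proof -
      have "a * (2 * (e / (8 * a * b))) = e / (4 * b)" if "a \<noteq> 0" for a b :: real
        using that by simp
      from this[of "norm y + 1" "real (card R + 1)"] show ?thesis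
        using add_nonneg_pos[OF norm_ge_zero[of y], of 1] unfolding \<eta>_def by linarith
    qed
    finally show "norm y * measure lebesgue (U y - C y) \<le> e / (4 * (card R + 1))" .
  qed
  also have "\<dots> \<le> e / 4" using e by (simp add: field_simps)
  finally have k2: "(LINT x|lebesgue. k x) \<le> e / 4" .
  \<comment> \<open>A point where \<open>s\<close> jumps between \<open>y\<close> and
    \<open>z\<close> lies in both collars, so \<open>k\<close> pays for both norms and hence for the
    jump.\<close>
  have k_ge: "norm y + norm z \<le> k x" if "y \<in> R" "x \<in> U y - C y" "z \<in> R" "x \<in> U z - C z" "y \<noteq> z" for x y z
  proof -
    define c where "c w = norm w * indicator (U w - C w) x" for w
    have "sum c {y, z} \<le> k x"
      unfolding k_def c_def using R that by (intro sum_mono2) auto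
    also have "sum c {y, z} = c y + c z" using that by simp
    finally show ?thesis using that by (simp add: c_def)
  qed
  show thesis
  proof
    show "integrable lebesgue (\<lambda>x. n x + k x)" using n1 k1 by simp
    show "0 \<le> n x + k x" for x using n0 k0 by simp
    show "(LINT x|lebesgue. n x + k x) < e" using n1 k1 n2 k2 e by simp
    fix t assume t: "t \<in> S"
    \<comment> \<open>Near \<open>t\<close> the point \<open>x\<close> stays in the open superset of
      the level set of \<open>t\<close> and outside the closed cores of all other level sets. If
      \<open>s x\<close> differs from \<open>s t\<close>, this puts \<open>x\<close> in the collars
      of both values.\<close>
    have "eventually (\<lambda>x. \<forall>y\<in>R. (t \<in> A y \<longrightarrow> x \<in> U y) \<and> (t \<notin> A y \<longrightarrow> x \<notin> C y)) (nhds t)"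
    proof (subst eventually_ball_finite_distrib[OF R], rule ballI)
      fix y
      show "eventually (\<lambda>x. (t \<in> A y \<longrightarrow> x \<in> U y) \<and> (t \<notin> A y \<longrightarrow> x \<notin> C y)) (nhds t)"
      proof (cases "t \<in> A y")
        case True
        then show ?thesis using eventually_nhds_in_open[OF UC(1)[of y], of t] UC(4)[of y] by auto
      next
        case False
        then show ?thesis using eventually_nhds_in_open[of "- C y" t] UC(2)[of y] UC(3)[of y]
          by (auto simp: open_Compl)
      qed
    qed
    then show "eventually (\<lambda>x. x \<in> S \<longrightarrow> norm (f x - f t) \<le> n x + k x + (n t + k t)) (nhds t)"
    proof (rule eventually_mono, intro impI)
      fix x assume x: "\<forall>y\<in>R. (t \<in> A y \<longrightarrow> x \<in> U y) \<and> (t \<notin> A y \<longrightarrow> x \<notin> C y)" and xS: "x \<in> S"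
      have R': "s x \<in> R" "s t \<in> R" using xS t by (auto simp: R_def)
      have "norm (s x - s t) \<le> k x"
      proof (cases "s x = s t")
        case True then show ?thesis using k0 by simp
      next
        case False
        have "x \<in> U (s x) - C (s x)" "x \<in> U (s t) - C (s t)"
          using x R' False xS t UC(3)[of "s t"] UC(4)[of "s x"] by (auto simp: A_def)
        then have "norm (s x) + norm (s t) \<le> k x" using False R' by (intro k_ge) auto
        then show ?thesis using norm_triangle_ineq4[of "s x" "s t"] by linarith
      qed
      moreover have "norm (f x - f t) \<le> norm (f x - s x) + norm (s x - s t) + norm (f t - s t)"
      proof -
        have "f x - f t = (f x - s x) + (s x - s t) - (f t - s t)" by simp
        then show ?thesis by (metis norm_triangle_ineq norm_triangle_ineq4 add_right_mono order_trans)
      qed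
      ultimately show "norm (f x - f t) \<le> n x + k x + (n t + k t)"
        using xS t k0[of t] by (simp add: n_def)
    qed
  qed
qed

text \<open>On the exceptional set the majorant may be redefined to be \<open>0\<close>; Henstock's lemma then bounds the
  contribution of the intervals tagged there.\<close>

lemma ac_increment_le_integral:
  fixes Z :: "real \<Rightarrow> real"
  assumes ab: "a \<le> b" and m: "m integrable_on {a..b}"
    and Z: "\<And>s t. a \<le> s \<Longrightarrow> s \<le> t \<Longrightarrow> t \<le> b \<Longrightarrow> \<bar>Z t - Z s\<bar> \<le> integral {s..t} m"
    and N: "negligible N"
    and deriv: "\<And>t. t \<in> {a..b} - N \<Longrightarrow> (Z has_real_derivative z t) (at t within {a..b})"
    and le: "\<And>t. t \<in> {a..b} - N \<Longrightarrow> z t \<le> h t"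
    and h: "h integrable_on {a..b}"
  shows "Z b - Z a \<le> integral {a..b} h"
proof -
  \<comment> \<open>The value 0 on \<open>N\<close> is what makes the Riemann terms with tags in
    \<open>N\<close> vanish for both functions, while integrals of \<open>m\<close> are
    unchanged.\<close>
  define z' where "z' t = (if t \<in> N then 0 else z t)" for t
  define m' where "m' t = (if t \<in> N then 0 else m t)" for t
  have m': "m' integrable_on cbox a b"
    using integrable_spike[OF m N, of m'] by (simp add: m'_def)
  have m'_eq: "integral K m' = integral K m" for K
    by (rule integral_spike[OF N]) (simp add: m'_def)
  have "(z' has_integral (Z b - Z a)) (cbox a b)"
    unfolding has_integral
  proof (intro allI impI)
    fix e :: real assume e: "0 < e"
    \<comment> \<open>Gives \<open>\<epsilon> * (b - a) \<le> e/2\<close>; the summand 1 keeps the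
      denominator positive when \<open>a = b\<close>.\<close>
    define \<epsilon> where "\<epsilon> = e / (2 * (b - a + 1))"
    have \<epsilon>: "\<epsilon> > 0" using e ab by (auto simp: \<epsilon>_def intro!: divide_pos_pos)
    obtain \<gamma> where \<gamma>: "gauge \<gamma>" "\<And>p. \<lbrakk>p tagged_partial_division_of (cbox a b); \<gamma> fine p\<rbrakk> \<Longrightarrow>
             sum (\<lambda>(x,k). norm(measure lborel k *\<^sub>R m' x - integral k m')) p < e/2"
      using Henstock_lemma[OF m', of "e/2"] e by auto
    \<comment> \<open>The radius at a differentiability point: both endpoints of an interval tagged
      there are compared with the tangent line at the tag.\<close>
    have "\<exists>d>0. t \<in> {a..b} - N \<longrightarrow> (\<forall>s\<in>{a..b}. \<bar>s - t\<bar> < d \<longrightarrow> \<bar>Z s - Z t - (s - t) * z t\<bar> \<le> \<epsilon> * \<bar>s - t\<bar>)" for t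
    proof (cases "t \<in> {a..b} - N")
      case True
      then have "(Z has_derivative (*) (z t)) (at t within {a..b})"
        using deriv[of t] by (simp add: has_field_derivative_def)
      then have "\<exists>d>0. \<forall>s\<in>{a..b}. norm (s - t) < d \<longrightarrow> norm (Z s - Z t - z t * (s - t)) \<le> \<epsilon> * norm (s - t)"
        using \<epsilon> unfolding has_derivative_within_alt by blast
      then show ?thesis by (auto simp: mult.commute)
    qed (auto intro: exI[of _ 1])
    then obtain d where d: "\<And>t. d t > 0"
      "\<And>t s. t \<in> {a..b} - N \<Longrightarrow> s \<in> {a..b} \<Longrightarrow> \<bar>s - t\<bar> < d t \<Longrightarrow> \<bar>Z s - Z t - (s - t) * z t\<bar> \<le> \<epsilon> * \<bar>s - t\<bar>"
      by metis
    have g2: "gauge (\<lambda>t. \<gamma> t \<inter> ball t (d t))"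
      using \<gamma>(1) d(1) by (intro gauge_Int gauge_ball_dependent) auto
    show "\<exists>\<gamma>. gauge \<gamma> \<and> (\<forall>\<D>. \<D> tagged_division_of cbox a b \<and> \<gamma> fine \<D> \<longrightarrow>
           norm ((\<Sum>(x,k)\<in>\<D>. measure lborel k *\<^sub>R z' x) - (Z b - Z a)) < e)"
    proof (intro exI[of _ "\<lambda>t. \<gamma> t \<inter> ball t (d t)"] conjI g2 allI impI, elim conjE)
      fix p assume p: "p tagged_division_of cbox a b" and fine: "(\<lambda>t. \<gamma> t \<inter> ball t (d t)) fine p"
      have p1: "p tagged_partial_division_of cbox a b" using p by (simp add: tagged_division_of_def)
      have fine1: "\<gamma> fine p" using fine by (simp add: fine_Int)
      have "(\<Sum>(x,k)\<in>p. measure lborel k *\<^sub>R z' x) - (Z b - Z a)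
          = (\<Sum>(x,k)\<in>p. measure lborel k *\<^sub>R z' x - (Z (Sup k) - Z (Inf k)))"
        using additive_tagged_division_1[OF ab, of p Z] p
        by (simp add: split_def sum_subtractf)
      also have "norm \<dots> \<le> (\<Sum>(x,k)\<in>p. \<epsilon> * measure lborel k + norm (measure lborel k *\<^sub>R m' x - integral k m'))"
        unfolding split_def
      proof (rule sum_norm_le, clarsimp)
        fix x k assume xk: "(x, k) \<in> p"
        obtain c l where k: "k = {c..l}" using tagged_division_ofD(4)[OF p xk] by auto
        have xk2: "x \<in> k" "k \<subseteq> {a..b}" using tagged_division_ofD(2,3)[OF p xk] by auto
        then have cl: "c \<le> x" "x \<le> l" "a \<le> c" "l \<le> b" "c \<le> l" using k by auto
        have kd: "k \<subseteq> ball x (d x)" using fine xk by (auto simp: fine_def)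
        show "\<bar>measure lborel k * z' x - (Z (Sup k) - Z (Inf k))\<bar> \<le> \<epsilon> * measure lborel k + \<bar>measure lborel k * m' x - integral k m'\<bar>"
        proof (cases "x \<in> N")
          \<comment> \<open>Here \<open>z' x = m' x = 0\<close>. The increment of \<open>Z\<close>
            is at most the integral of \<open>m\<close> over \<open>k\<close>, which is exactly the
            deviation that Henstock's lemma sums to less than \<open>e/2\<close>.\<close>
          case True
          have "\<bar>Z l - Z c\<bar> \<le> integral k m'" using Z[of c l] cl by (simp add: m'_eq k)
          moreover have "0 \<le> \<epsilon> * (l - c)" using \<epsilon> cl by simp
          ultimately show ?thesis using True cl by (simp add: z'_def m'_def k)
        next
          case False
          then have x: "x \<in> {a..b} - N" using xk2 by auto
          have "c \<in> k" "l \<in> k" using k cl by auto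
          then have "c \<in> ball x (d x)" "l \<in> ball x (d x)" using kd by blast+
          then have "\<bar>Z c - Z x - (c - x) * z x\<bar> \<le> \<epsilon> * \<bar>c - x\<bar>" "\<bar>Z l - Z x - (l - x) * z x\<bar> \<le> \<epsilon> * \<bar>l - x\<bar>"
            using d(2)[OF x, of c] d(2)[OF x, of l] cl by (auto simp: dist_real_def)
          moreover have "(l - c) * z x - (Z l - Z c) = (Z c - Z x - (c - x) * z x) - (Z l - Z x - (l - x) * z x)"
            by (simp add: algebra_simps)
          moreover have "\<epsilon> * \<bar>c - x\<bar> + \<epsilon> * \<bar>l - x\<bar> = \<epsilon> * (l - c)" using cl by (simp add: algebra_simps)
          ultimately have "\<bar>(l - c) * z x - (Z l - Z c)\<bar> \<le> \<epsilon> * (l - c)" by linarith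
          then show ?thesis using False cl by (simp add: z'_def k)
        qed
      qed
      also have "\<dots> = \<epsilon> * (b - a) + (\<Sum>(x,k)\<in>p. norm (measure lborel k *\<^sub>R m' x - integral k m'))"
        using additive_content_tagged_division[OF p] ab
        by (simp add: split_def sum.distrib flip: sum_distrib_left)
      also have "\<dots> < \<epsilon> * (b - a) + e/2" using \<gamma>(2)[OF p1 fine1] by simp
      also have "\<dots> \<le> e" using e ab by (simp add: \<epsilon>_def field_simps)
      finally show "norm ((\<Sum>(x,k)\<in>p. measure lborel k *\<^sub>R z' x) - (Z b - Z a)) < e" .
    qed
  qed
  moreover have "((\<lambda>t. if t \<in> N then 0 else h t) has_integral integral {a..b} h) {a..b}"
    using has_integral_spike[OF N _ integrable_integral[OF h]] by simp
  ultimately show ?thesis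
    by (intro has_integral_le[of z' "Z b - Z a" "{a..b}"]) (use le in \<open>auto simp: z'_def\<close>)
qed

section \<open>Weak derivatives are classical derivatives almost everywhere\<close>

lemma has_bochner_integral_lebesgue_on_has_integral:
  "has_bochner_integral (lebesgue_on S) f x \<Longrightarrow> S \<in> sets lebesgue \<Longrightarrow> (f has_integral x) S"
  for f :: "real \<Rightarrow> real"
  using has_integral_integral_lebesgue_on by (auto simp: has_bochner_integral_iff)

lemma weak_derivative_norm_integrable:
  fixes u :: "real \<Rightarrow> 'b::real_normed_vector"
  assumes u: "has_weak_derivative u u'" and a: "0 \<le> a"
  shows "(\<lambda>s. norm (u' s - c)) integrable_on {a..b}"
proof (cases "a \<le> b")
  case True
  with u a have hs: "has_strong_integral (lebesgue_on {0..b}) u' (u b - u 0)"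
    by (simp add: has_weak_derivative_def)
  then have m: "u' \<in> borel_measurable (lebesgue_on {0..b})" by (simp add: has_strong_integral_def)
  have "integrable (lebesgue_on {0..b}) (\<lambda>s. norm (u' s - c))"
  proof (rule Bochner_Integration.integrable_bound)
    show "integrable (lebesgue_on {0..b}) (\<lambda>s. norm (u' s) + norm c)"
      using has_strong_integral_norm_integrable[OF hs]
      by (intro Bochner_Integration.integrable_add finite_measure.integrable_const finite_measure_lebesgue_on) auto
    show "(\<lambda>s. norm (u' s - c)) \<in> borel_measurable (lebesgue_on {0..b})"
      by (rule borel_measurable_continuous_on[OF _ m]) (intro continuous_intros)
  qed (auto intro: norm_triangle_ineq4)
  then have "(\<lambda>s. norm (u' s - c)) integrable_on {0..b}"
    by (rule integrable_on_lebesgue_on) auto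
  then show ?thesis
    by (rule integrable_on_subinterval) (use a in auto)
qed auto

text \<open>Testing with the increment itself reduces the estimate to real-valued integrals.\<close>

lemma weak_derivative_increment_bound:
  fixes u :: "real \<Rightarrow> 'b::real_inner"
  assumes u: "has_weak_derivative u u'" and ab: "0 \<le> a" "a \<le> b"
  shows "norm (u b - u a - (b - a) *\<^sub>R c) \<le> integral {a..b} (\<lambda>s. norm (u' s - c))"
proof -
  define y where "y = u b - u a - (b - a) *\<^sub>R c"
  have "inner y y = inner y (u b - u a - (b - a) *\<^sub>R c)"
    by (simp only: y_def)
  then have yy: "(norm y)\<^sup>2 = inner y (u b - u a) - (b - a) * inner y c"
    by (simp add: power2_norm_eq_inner inner_diff_right)
  have hi: "((\<lambda>s. inner y (u' s)) has_integral inner y (u t - u 0)) {0..t}" if "0 \<le> t" for t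
  proof -
    have "has_strong_integral (lebesgue_on {0..t}) u' (u t - u 0)"
      using u that by (simp add: has_weak_derivative_def)
    from has_strong_integral_bounded_linear[OF bounded_linear_inner_right this]
    show ?thesis by (rule has_bochner_integral_lebesgue_on_has_integral) simp
  qed
  have int: "(\<lambda>s. inner y (u' s)) integrable_on {0..b}" using hi[of b] ab by (auto simp: integrable_on_def)
  have "integral {0..a} (\<lambda>s. inner y (u' s)) + integral {a..b} (\<lambda>s. inner y (u' s)) = integral {0..b} (\<lambda>s. inner y (u' s))"
    by (rule Henstock_Kurzweil_Integration.integral_combine) (use ab int in auto)
  then have eq: "integral {a..b} (\<lambda>s. inner y (u' s)) = inner y (u b - u a)"
    using hi[of a, THEN integral_unique] hi[of b, THEN integral_unique] ab by (simp add: inner_diff_right)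
  have int': "(\<lambda>s. inner y (u' s)) integrable_on {a..b}"
    using int by (rule integrable_on_subinterval) (use ab in auto)
  have "((\<lambda>s. inner y (u' s) - inner y c) has_integral inner y (u b - u a) - (b - a) * inner y c) {a..b}"
    using int' eq has_integral_const_real[of "inner y c" a b] ab
    by (intro has_integral_diff) (auto simp: has_integral_iff)
  then have 1: "((\<lambda>s. inner y (u' s - c)) has_integral (norm y)\<^sup>2) {a..b}"
    using yy by (simp add: inner_diff_right)
  have 2: "((\<lambda>s. norm y * norm (u' s - c)) has_integral norm y * integral {a..b} (\<lambda>s. norm (u' s - c))) {a..b}"
    using weak_derivative_norm_integrable[OF u ab(1), of c b] by (intro has_integral_mult_right integrable_integral)
  have "(norm y)\<^sup>2 \<le> norm y * integral {a..b} (\<lambda>s. norm (u' s - c))"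
    by (rule has_integral_le[OF 1 2]) (rule norm_cauchy_schwarz)
  then have "norm y \<le> integral {a..b} (\<lambda>s. norm (u' s - c)) \<or> y = 0"
    by (auto simp: power2_eq_square)
  moreover have "0 \<le> integral {a..b} (\<lambda>s. norm (u' s - c))"
    by (rule integral_nonneg[OF weak_derivative_norm_integrable[OF u ab(1)]]) auto
  ultimately show ?thesis by (auto simp: y_def)
qed

lemma weak_derivative_bound:
  fixes u :: "real \<Rightarrow> 'b::real_inner"
  assumes "has_weak_derivative u u'" and "0 \<le> a" "a \<le> b"
  shows "norm (u b - u a) \<le> integral {a..b} (\<lambda>s. norm (u' s))"
  using weak_derivative_increment_bound[OF assms, of 0] by simp

text \<open>Lebesgue differentiation. A point where the difference quotients miss
  \<open>u' t\<close> by more than \<open>1 / Suc n\<close> arbitrarily near must lie where the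
  majorant \<open>m\<close> of the oscillation of \<open>u'\<close>, or its maximal function, is
  large. Both sets have measure controlled by the integral of \<open>m\<close>, which can be made
  arbitrarily small.\<close>

lemma weak_derivative_has_vector_derivative:
  fixes u :: "real \<Rightarrow> 'b::real_inner"
  assumes u: "has_weak_derivative u u'"
  shows "AE t in lebesgue. 0 < t \<longrightarrow> (u has_vector_derivative u' t) (at t)"
proof -
  define good where "good n t \<longleftrightarrow> (\<exists>d>0. \<forall>s. \<bar>s - t\<bar> < d \<longrightarrow>
      norm (u s - u t - (s - t) *\<^sub>R u' t) \<le> \<bar>s - t\<bar> / Suc n)" for n and t :: real
  \<comment> \<open>The bound \<open>t < Suc n\<close> keeps the points in an interval on which
    \<open>u'\<close> is strongly integrable, with room on both sides of \<open>t\<close>.\<close>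
  define B where "B n = {t::real. 0 < t \<and> t < Suc n \<and> \<not> good n t}" for n
  have "negligible (B n)" for n
    unfolding negligible_outer_le
  proof (intro allI impI)
    fix e :: real assume e: "0 < e"
    define S where "S = {0..real (Suc n)}"
    define lam where "lam = 1 / real (Suc n)"
    have lam: "lam > 0" by (simp add: lam_def)
    have hs: "has_strong_integral (lebesgue_on S) u' (u (Suc n) - u 0)"
      using u by (simp add: has_weak_derivative_def S_def)
    \<comment> \<open>The maximal function is cut at level \<open>lam / 4\<close> and
      \<open>m\<close> itself at \<open>lam / 2\<close>. The two exceptional sets cost
      \<open>40 / lam\<close> and \<open>2 / lam\<close> times the integral of \<open>m\<close>,
      hence the 42.\<close>
    obtain m where m: "integrable lebesgue m" "\<And>x. 0 \<le> m x" "(LINT x|lebesgue. m x) < e * lam / 42"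
      "\<And>t. t \<in> S \<Longrightarrow> eventually (\<lambda>x. x \<in> S \<longrightarrow> norm (u' x - u' t) \<le> m x + m t) (nhds t)"
      by (rule strongly_integrable_almost_continuous[OF hs, of "e * lam / 42"]) (use e lam in \<open>auto simp: S_def\<close>)
    obtain M where M: "M \<in> lmeasurable" "measure lebesgue M \<le> 10 / (lam / 4) * (LINT x|lebesgue. m x)"
      "\<And>t r. t \<notin> M \<Longrightarrow> 0 < r \<Longrightarrow> r \<le> 1 \<Longrightarrow> (LINT x:ball t r|lebesgue. m x) \<le> (lam / 4) * r"
      by (rule maximal_inequality[OF m(1,2), of "lam / 4"]) (use lam in auto)
    define M' where "M' = {x. lam / 2 \<le> m x}"
    have M': "measure lebesgue M' \<le> (LINT x|lebesgue. m x) / (lam / 2)"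
      using integral_Markov_inequality_measure[OF m(1), of "{}" "lam / 2"] m(2) lam by (simp add: M'_def)
    have "emeasure lebesgue M' < \<infinity>"
      using integral_Markov_inequality[OF m(1), of "lam / 2"] m(2) lam
      by (auto simp: M'_def intro: le_less_trans)
    moreover have "M' \<in> sets lebesgue"
    proof -
      have "m -` {lam / 2..} \<inter> space lebesgue \<in> sets lebesgue"
        by (rule measurable_sets[OF borel_measurable_integrable[OF m(1)]]) simp
      then show ?thesis by (simp add: M'_def vimage_def)
    qed
    ultimately have M'_meas: "M' \<in> lmeasurable" by (auto simp: fmeasurable_def)
    have "measure lebesgue (M \<union> M') \<le> measure lebesgue M + measure lebesgue M'"
      using M(1) M'_meas by (intro measure_Un_le) auto
    also have "\<dots> \<le> 42 / lam * (LINT x|lebesgue. m x)"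
    proof -
      have "42 / lam * (LINT x|lebesgue. m x) = 10 / (lam / 4) * (LINT x|lebesgue. m x) + (LINT x|lebesgue. m x) / (lam / 2)"
        by (simp add: field_simps)
      then show ?thesis using M(2) M' by linarith
    qed
    also have "\<dots> \<le> e" using m(3) lam by (simp add: field_simps)
    finally have le_e: "measure lebesgue (M \<union> M') \<le> e" .
    have "B n \<subseteq> M \<union> M'"
    proof (rule subsetI, rule ccontr)
      fix t assume t: "t \<in> B n" and "t \<notin> M \<union> M'"
      then have tM: "t \<notin> M" "m t \<le> lam / 2" and tS: "0 < t" "t < Suc n" "t \<in> S"
        by (auto simp: M'_def B_def S_def)
      have "eventually (\<lambda>x. norm (u' x - u' t) \<le> m x + m t \<and> x \<in> {0<..<real (Suc n)}) (nhds t)"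
      proof -
        have "eventually (\<lambda>x. x \<in> {0<..<real (Suc n)}) (nhds t)"
          by (rule eventually_nhds_in_open) (use tS in auto)
        with m(4)[OF tS(3)] show ?thesis by eventually_elim (auto simp: S_def)
      qed
      then obtain d where d: "d > 0" "\<And>x. dist x t < d \<Longrightarrow> norm (u' x - u' t) \<le> m x + m t \<and> 0 < x \<and> x < Suc n"
        by (auto simp: eventually_nhds_metric)
      have "norm (u s - u t - (s - t) *\<^sub>R u' t) \<le> \<bar>s - t\<bar> / Suc n" if s: "\<bar>s - t\<bar> < min d (1/2)" for s
      proof (cases "s = t")
        case False
        \<comment> \<open>With twice the distance as radius the open ball contains the closed
          interval between \<open>s\<close> and \<open>t\<close>, and
          \<open>\<bar>s - t\<bar> < 1/2\<close> gives \<open>r \<le> 1\<close>. The two levels then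
          contribute half of \<open>lam * \<bar>s - t\<bar>\<close> each.\<close>
        define a b r where "a = min s t" and "b = max s t" and "r = 2 * \<bar>s - t\<bar>"
        have ab: "0 \<le> a" "a \<le> b" "b - a = \<bar>s - t\<bar>" "0 < r" "r \<le> 1"
          using d(2)[of s] s tS False by (auto simp: a_def b_def r_def dist_real_def)
        have sub: "{a..b} \<subseteq> ball t r"
          using False by (auto simp: a_def b_def r_def dist_real_def min_def max_def split: if_splits)
        have si: "set_integrable lebesgue (ball t r) m"
          unfolding set_integrable_def by (rule integrable_mult_indicator) (use m in auto)
        have mi: "m integrable_on ball t r" using set_lebesgue_integral_eq_integral(1)[OF si] .
        have mi': "m integrable_on {a..b}"
          by (rule integrable_on_subinterval[OF mi]) (use sub in auto)
        have "norm (u s - u t - (s - t) *\<^sub>R u' t) = norm (u b - u a - (b - a) *\<^sub>R u' t)"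
          by (auto simp: a_def b_def max_def min_def norm_minus_commute algebra_simps)
        also have "\<dots> \<le> integral {a..b} (\<lambda>x. norm (u' x - u' t))"
          by (rule weak_derivative_increment_bound[OF u ab(1,2)])
        also have "\<dots> \<le> integral {a..b} (\<lambda>x. m x + m t)"
        proof (rule integral_le[OF weak_derivative_norm_integrable[OF u ab(1)]])
          show "(\<lambda>x. m x + m t) integrable_on {a..b}" by (intro integrable_add mi') auto
          fix x assume "x \<in> {a..b}"
          then have "dist x t < d" using s by (auto simp: a_def b_def dist_real_def)
          then show "norm (u' x - u' t) \<le> m x + m t" using d(2) by blast
        qed
        also have "\<dots> = integral {a..b} m + (b - a) * m t"
          using mi' ab by (subst Henstock_Kurzweil_Integration.integral_add) auto
        also have "integral {a..b} m \<le> integral (ball t r) m"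
          by (rule integral_subset_le[OF sub mi' mi]) (use m in auto)
        also have "\<dots> = (LINT x:ball t r|lebesgue. m x)" using set_lebesgue_integral_eq_integral(2)[OF si] by simp
        also have "\<dots> \<le> lam / 4 * r" using M(3) tM ab by auto
        also have "(b - a) * m t \<le> (b - a) * (lam / 2)" using tM ab by (intro mult_left_mono) auto
        also have "lam / 4 * r + (b - a) * (lam / 2) = lam * \<bar>s - t\<bar>"
          unfolding ab(3) r_def by (simp add: field_simps)
        finally show ?thesis by (simp add: lam_def)
      qed auto
      then have "good n t" unfolding good_def using d(1) by (intro exI[of _ "min d (1/2)"]) auto
      with t show False by (simp add: B_def)
    qed
    then show "\<exists>T. B n \<subseteq> T \<and> T \<in> lmeasurable \<and> measure lebesgue T \<le> e"
      using le_e M(1) M'_meas by (intro exI[of _ "M \<union> M'"]) auto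
  qed
  then have neg: "negligible (\<Union>n. B n)" by (intro negligible_countable_Union) auto
  have "AE t in lebesgue. t \<notin> (\<Union>n. B n)"
    using neg by (metis AE_not_in negligible_iff_null_sets)
  then show ?thesis
  proof (rule AE_mp, intro AE_I2 impI)
    fix t assume t: "t \<notin> (\<Union>n. B n)" "0 < (t::real)"
    show "(u has_vector_derivative u' t) (at t)"
      unfolding has_vector_derivative_def has_derivative_at_alt
    proof (intro conjI allI impI)
      show "bounded_linear (\<lambda>x. x *\<^sub>R u' t)" by (rule bounded_linear_scaleR_left)
      fix e :: real assume "0 < e"
      then obtain n where n: "inverse (Suc n) < e" using reals_Archimedean by blast
      obtain k :: nat where k: "t < k" using reals_Archimedean2 by blast
      \<comment> \<open>\<open>n\<close> supplies the accuracy, \<open>k\<close> places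
        \<open>t\<close> below the upper limit in \<open>B\<close>.\<close>
      have "good (max n k) t" using t k by (auto simp: B_def)
      then obtain d where d: "d > 0" "\<And>s. \<bar>s - t\<bar> < d \<Longrightarrow> norm (u s - u t - (s - t) *\<^sub>R u' t) \<le> \<bar>s - t\<bar> / Suc (max n k)"
        by (auto simp: good_def)
      have "\<bar>s - t\<bar> / Suc (max n k) \<le> e * \<bar>s - t\<bar>" for s
      proof -
        have "1 / Suc (max n k) \<le> 1 / Suc n" by (intro divide_left_mono) auto
        also have "\<dots> < e" using n by (simp add: inverse_eq_divide)
        finally have "1 / Suc (max n k) * \<bar>s - t\<bar> \<le> e * \<bar>s - t\<bar>" by (intro mult_right_mono) auto
        then show ?thesis by simp
      qed
      then show "\<exists>d>0. \<forall>y. norm (y - t) < d \<longrightarrow> norm (u y - u t - (y - t) *\<^sub>R u' t) \<le> e * norm (y - t)"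
        using d by (intro exI[of _ d]) (force intro: order_trans)
    qed
  qed
qed

section \<open>Absolutely continuous functions\<close>

text \<open>Absolute continuity, encoded as domination of all increments by the integrals of one
  real function. In this form it passes through Lipschitz combinations and is what
  \<open>ac_increment_le_integral\<close> requires.\<close>

definition ac_on :: "real \<Rightarrow> real \<Rightarrow> (real \<Rightarrow> 'b::real_normed_vector) \<Rightarrow> bool" where
  "ac_on a b Z \<longleftrightarrow> (\<exists>m. m integrable_on {a..b} \<and>
     (\<forall>s t. a \<le> s \<longrightarrow> s \<le> t \<longrightarrow> t \<le> b \<longrightarrow> norm (Z t - Z s) \<le> integral {s..t} m))"

lemma ac_on_weak_derivative:
  fixes u :: "real \<Rightarrow> 'b::real_inner"
  assumes "has_weak_derivative u u'" "0 \<le> a"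
  shows "ac_on a b u"
  unfolding ac_on_def
  using weak_derivative_norm_integrable[OF assms, of 0 b] weak_derivative_bound[OF assms(1)] assms(2)
  by (intro exI[of _ "\<lambda>s. norm (u' s)"]) auto

lemma ac_on_continuous:
  assumes "ac_on a b Z"
  shows "continuous_on {a..b} Z"
proof -
  from assms obtain m where m: "m integrable_on {a..b}"
    "\<And>s t. a \<le> s \<Longrightarrow> s \<le> t \<Longrightarrow> t \<le> b \<Longrightarrow> norm (Z t - Z s) \<le> integral {s..t} m"
    by (auto simp: ac_on_def)
  define I where "I t = integral {a..t} m" for t
  have I: "continuous_on {a..b} I"
    unfolding I_def by (rule indefinite_integral_continuous_1[OF m(1)])
  have eq: "integral {s..t} m = I t - I s" if "a \<le> s" "s \<le> t" "t \<le> b" for s t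
    using Henstock_Kurzweil_Integration.integral_combine[of a s t m] that
      integrable_on_subinterval[OF m(1), of a t] by (simp add: I_def)
  have bd: "dist (Z s) (Z t) \<le> dist (I s) (I t)" if "s \<in> {a..b}" "t \<in> {a..b}" for s t
  proof (cases "s \<le> t")
    case True
    then show ?thesis using m(2)[of s t] eq[of s t] that by (simp add: dist_norm norm_minus_commute)
  next
    case False
    then show ?thesis using m(2)[of t s] eq[of t s] that by (simp add: dist_norm norm_minus_commute)
  qed
  show ?thesis
    using I bd unfolding continuous_on_iff by (meson le_less_trans)
qed

lemma ac_on_bounded:
  assumes "ac_on a b Z"
  obtains R where "R > 0" "\<And>t. t \<in> {a..b} \<Longrightarrow> norm (Z t) \<le> R"
proof -
  have "bounded (Z ` {a..b})"
    by (rule compact_imp_bounded[OF compact_continuous_image[OF ac_on_continuous[OF assms]]]) simp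
  then show thesis using that by (auto simp: bounded_pos)
qed

text \<open>The one closure principle behind sums, products and smooth functions: a Lipschitz bound
  of \<open>Z\<close> by \<open>X\<close> and \<open>Y\<close> transfers the majorants. For a single
  function, \<open>Y\<close> is taken constant.\<close>

lemma ac_on_combine:
  assumes X: "ac_on a b X" and Y: "ac_on a b Y"
    and Z: "\<And>s t. s \<in> {a..b} \<Longrightarrow> t \<in> {a..b} \<Longrightarrow> norm (Z t - Z s) \<le> L * (norm (X t - X s) + norm (Y t - Y s))"
  shows "ac_on a b Z"
proof -
  from X obtain m where m: "m integrable_on {a..b}"
    "\<And>s t. a \<le> s \<Longrightarrow> s \<le> t \<Longrightarrow> t \<le> b \<Longrightarrow> norm (X t - X s) \<le> integral {s..t} m"
    by (auto simp: ac_on_def)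
  from Y obtain n where n: "n integrable_on {a..b}"
    "\<And>s t. a \<le> s \<Longrightarrow> s \<le> t \<Longrightarrow> t \<le> b \<Longrightarrow> norm (Y t - Y s) \<le> integral {s..t} n"
    by (auto simp: ac_on_def)
  show ?thesis
    unfolding ac_on_def
  proof (intro exI conjI allI impI)
    show "(\<lambda>x. \<bar>L\<bar> * (m x + n x)) integrable_on {a..b}"
      using m(1) n(1) by (intro integrable_on_mult_right integrable_add)
    fix s t assume st: "a \<le> s" "s \<le> t" "t \<le> b"
    have sub: "m integrable_on {s..t}" "n integrable_on {s..t}"
      using integrable_on_subinterval[OF m(1)] integrable_on_subinterval[OF n(1)] st by auto
    have "norm (Z t - Z s) \<le> L * (norm (X t - X s) + norm (Y t - Y s))" using Z st by auto
    also have "\<dots> \<le> \<bar>L\<bar> * (norm (X t - X s) + norm (Y t - Y s))" by (intro mult_right_mono) auto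
    also have "\<dots> \<le> \<bar>L\<bar> * (integral {s..t} m + integral {s..t} n)"
      using m(2) n(2) st by (intro mult_left_mono add_mono) auto
    also have "\<dots> = integral {s..t} (\<lambda>x. \<bar>L\<bar> * (m x + n x))"
      using sub by (simp add: Henstock_Kurzweil_Integration.integral_add)
    finally show "norm (Z t - Z s) \<le> integral {s..t} (\<lambda>x. \<bar>L\<bar> * (m x + n x))" .
  qed
qed

lemma ac_on_const: "ac_on a b (\<lambda>_. c)"
  unfolding ac_on_def by (intro exI[of _ "\<lambda>_. 0"]) auto

lemma ac_on_add:
  assumes X: "ac_on a b X" and Y: "ac_on a b Y"
  shows "ac_on a b (\<lambda>t. X t + Y t)"
  by (rule ac_on_combine[OF assms, of _ 1]) (simp add: add_diff_add norm_triangle_ineq)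

lemma ac_on_bilinear:
  assumes B: "bounded_bilinear B" and X: "ac_on a b X" and Y: "ac_on a b Y"
  shows "ac_on a b (\<lambda>t. B (X t) (Y t))"
proof -
  interpret bounded_bilinear B by fact
  obtain K where K: "K > 0" "\<And>x y. norm (B x y) \<le> norm x * norm y * K" using pos_bounded by blast
  obtain R1 where R1: "R1 > 0" "\<And>t. t \<in> {a..b} \<Longrightarrow> norm (X t) \<le> R1" using ac_on_bounded[OF X] by blast
  obtain R2 where R2: "R2 > 0" "\<And>t. t \<in> {a..b} \<Longrightarrow> norm (Y t) \<le> R2" using ac_on_bounded[OF Y] by blast
  show ?thesis
  proof (rule ac_on_combine[OF X Y])
    fix s t assume st: "s \<in> {a..b}" "t \<in> {a..b}"
    have "B (X t) (Y t) - B (X s) (Y s) = B (X t - X s) (Y t) + B (X s) (Y t - Y s)"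
      by (simp add: diff_left diff_right)
    also have "norm \<dots> \<le> norm (X t - X s) * norm (Y t) * K + norm (X s) * norm (Y t - Y s) * K"
      by (intro order_trans[OF norm_triangle_ineq] add_mono K)
    also have "\<dots> \<le> norm (X t - X s) * (R1 + R2) * K + (R1 + R2) * norm (Y t - Y s) * K"
      using R1(1) R1(2)[OF st(1)] R2(1) R2(2)[OF st(2)] K(1)
      by (intro add_mono mult_right_mono mult_left_mono) auto
    also have "\<dots> = (R1 + R2) * K * (norm (X t - X s) + norm (Y t - Y s))" by (simp add: algebra_simps)
    finally show "norm (B (X t) (Y t) - B (X s) (Y s)) \<le> (R1 + R2) * K * (norm (X t - X s) + norm (Y t - Y s))" .
  qed
qed

lemmas ac_on_mult = ac_on_bilinear[OF bounded_bilinear_mult]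
lemmas ac_on_inner = ac_on_bilinear[OF bounded_bilinear_inner]

lemma ac_on_diff:
  assumes X: "ac_on a b X" and Y: "ac_on a b Y"
  shows "ac_on a b (\<lambda>t. X t - Y t)"
proof (rule ac_on_combine[OF assms, of _ 1])
  fix s t
  have eq: "X t - Y t - (X s - Y s) = (X t - X s) - (Y t - Y s)" by simp
  show "norm (X t - Y t - (X s - Y s)) \<le> 1 * (norm (X t - X s) + norm (Y t - Y s))"
    unfolding eq using norm_triangle_ineq4[of "X t - X s" "Y t - Y s"] by simp
qed

lemma ac_on_C1:
  fixes Z Z' :: "real \<Rightarrow> real"
  assumes "\<And>t. t \<in> {a..b} \<Longrightarrow> (Z has_real_derivative Z' t) (at t within {a..b})" "continuous_on {a..b} Z'"
  shows "ac_on a b Z"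
proof -
  have "bounded (Z' ` {a..b})"
    by (rule compact_imp_bounded[OF compact_continuous_image[OF assms(2)]]) simp
  then obtain L where L: "\<And>t. t \<in> {a..b} \<Longrightarrow> norm (Z' t) \<le> L"
    unfolding bounded_iff by blast
  have id: "ac_on a b (\<lambda>t::real. t)"
    unfolding ac_on_def by (intro exI[of _ "\<lambda>_. 1"]) auto
  show ?thesis
  proof (rule ac_on_combine[OF id ac_on_const[of _ _ "0::real"], of _ L])
    fix s t assume "s \<in> {a..b}" "t \<in> {a..b}"
    then show "norm (Z t - Z s) \<le> L * (norm (t - s) + norm (0 - 0 :: real))"
      using field_differentiable_bound[OF convex_real_interval(5) assms(1) L, of t s] by simp
  qed
qed

lemma ac_on_powr: "0 \<le> a \<Longrightarrow> ac_on a b (\<lambda>t. (1 + t) powr r)"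
  by (rule ac_on_C1[where Z' = "\<lambda>t. r * (1 + t) powr (r - 1)"])
    (auto intro!: derivative_eq_intros continuous_intros)

lemma ac_on_increment:
  fixes Z :: "real \<Rightarrow> real"
  assumes ac: "ac_on a b Z" and ab: "a \<le> b" and h: "h integrable_on {a..b}"
    and deriv: "AE t in lebesgue. a < t \<longrightarrow> t < b \<longrightarrow> (\<exists>z\<le>h t. (Z has_real_derivative z) (at t))"
  shows "Z b - Z a \<le> integral {a..b} h"
proof -
  define good where "good t \<longleftrightarrow> (\<exists>z\<le>h t. (Z has_real_derivative z) (at t))" for t
  obtain N0 where N0: "N0 \<in> null_sets lebesgue" "{t. \<not> (a < t \<longrightarrow> t < b \<longrightarrow> good t)} \<subseteq> N0"
    using deriv by (auto simp: eventually_ae_filter good_def)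
  \<comment> \<open>The endpoints join the null set because \<open>deriv\<close> speaks only of
    interior points.\<close>
  define N where "N = N0 \<union> {a, b}"
  have N: "negligible N" using N0 by (auto simp: N_def negligible_iff_null_sets)
  have "\<forall>t. \<exists>z. t \<in> {a..b} - N \<longrightarrow> z \<le> h t \<and> (Z has_real_derivative z) (at t)"
  proof
    fix t
    show "\<exists>z. t \<in> {a..b} - N \<longrightarrow> z \<le> h t \<and> (Z has_real_derivative z) (at t)"
    proof (cases "t \<in> {a..b} - N")
      case True
      then have "good t" using N0(2) by (auto simp: N_def less_le)
      then show ?thesis by (auto simp: good_def)
    qed auto
  qed
  then obtain z where z: "\<And>t. t \<in> {a..b} - N \<Longrightarrow> z t \<le> h t \<and> (Z has_real_derivative z t) (at t)"
    by metis
  from ac obtain m where m: "m integrable_on {a..b}"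
    "\<And>s t. a \<le> s \<Longrightarrow> s \<le> t \<Longrightarrow> t \<le> b \<Longrightarrow> norm (Z t - Z s) \<le> integral {s..t} m"
    by (auto simp: ac_on_def)
  show ?thesis
    by (rule ac_increment_le_integral[OF ab m(1) _ N _ _ h, of Z z])
      (use m(2) z in \<open>auto intro: has_field_derivative_at_within\<close>)
qed

section \<open>Product rule, weighted squares and tails of integrals\<close>

lemma inner_has_real_derivative:
  fixes x y :: "real \<Rightarrow> 'b::real_inner"
  assumes "(x has_vector_derivative x') (at t)" "(y has_vector_derivative y') (at t)"
  shows "((\<lambda>t. inner (x t) (y t)) has_real_derivative inner x' (y t) + inner (x t) y') (at t)"
  using bounded_bilinear.has_vector_derivative[OF bounded_bilinear_inner assms]
  by (simp add: has_real_derivative_iff_has_vector_derivative add.commute)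

lemma incseq_bounded_increments_small:
  fixes f :: "real \<Rightarrow> real"
  assumes mono: "\<And>s t. a \<le> s \<Longrightarrow> s \<le> t \<Longrightarrow> f s \<le> f t" and bound: "\<And>t. a \<le> t \<Longrightarrow> f t \<le> C" and e: "0 < e"
  obtains s where "a \<le> s" "\<And>t r. s \<le> t \<Longrightarrow> t \<le> r \<Longrightarrow> f r - f t < e"
proof -
  define L where "L = (SUP t\<in>{a..}. f t)"
  have bdd: "bdd_above (f ` {a..})" using bound by (auto intro: bdd_aboveI2[where M = C])
  have "L - e < L" using e by simp
  then obtain s where s: "a \<le> s" "L - e < f s"
    unfolding L_def using less_cSUP_iff[OF _ bdd] by (metis atLeast_iff empty_iff order_refl)
  have "f r - f t < e" if "s \<le> t" "t \<le> r" for t r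
  proof -
    have "f r \<le> L" unfolding L_def using s that by (intro cSUP_upper bdd) auto
    moreover have "f s \<le> f t" using s that by (intro mono) auto
    ultimately show ?thesis using s by linarith
  qed
  with s show thesis using that by blast
qed

text \<open>Young's inequality; \<open>1 \<le> 4 * c * d\<close> is the discriminant condition for
  the form \<open>c * a\<^sup>2 - a * b + d * b\<^sup>2\<close> to be nonnegative.\<close>

lemma mult_le_weighted_squares:
  fixes a b c d :: real
  assumes "0 < c" "1 \<le> 4 * c * d"
  shows "a * b \<le> c * a\<^sup>2 + d * b\<^sup>2"
proof -
  have d: "1 / (4 * c) \<le> d" using assms by (simp add: field_simps)
  have "0 \<le> (2 * c * a - b)\<^sup>2 / (4 * c)" using assms by simp
  also have "\<dots> = c * a\<^sup>2 - a * b + 1 / (4 * c) * b\<^sup>2"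
    using assms by (simp add: power2_eq_square field_simps)
  finally have "a * b \<le> c * a\<^sup>2 + 1 / (4 * c) * b\<^sup>2" by simp
  also have "\<dots> \<le> c * a\<^sup>2 + d * b\<^sup>2" using d by (intro add_left_mono mult_right_mono) auto
  finally show ?thesis .
qed

lemma integral_tail_small:
  fixes h :: "real \<Rightarrow> real"
  assumes int: "\<And>t. h integrable_on {a..t}" and nonneg: "\<And>t. a \<le> t \<Longrightarrow> 0 \<le> h t"
    and bound: "\<And>t. a \<le> t \<Longrightarrow> integral {a..t} h \<le> c" and e: "0 < e"
  obtains s where "a \<le> s" "\<And>t r. s \<le> t \<Longrightarrow> t \<le> r \<Longrightarrow> integral {t..r} h < e"
proof -
  have split: "integral {a..r} h = integral {a..t} h + integral {t..r} h" if "a \<le> t" "t \<le> r" for t r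
    using Henstock_Kurzweil_Integration.integral_combine[OF that int] by simp
  have pos: "0 \<le> integral {t..r} h" if "a \<le> t" for t r
    using integrable_on_subinterval[OF int[of r], of t r] nonneg that by (intro integral_nonneg) auto
  have mono: "integral {a..t} h \<le> integral {a..r} h" if "a \<le> t" "t \<le> r" for t r
    using split[OF that] pos[OF that(1), of r] by linarith
  obtain s where s: "a \<le> s" "\<And>t r. s \<le> t \<Longrightarrow> t \<le> r \<Longrightarrow> integral {a..r} h - integral {a..t} h < e"
    using incseq_bounded_increments_small[of a "\<lambda>t. integral {a..t} h", OF mono bound e] by metis
  show thesis
  proof (rule that[OF s(1)])
    fix t r assume "s \<le> t" "t \<le> r"
    then show "integral {t..r} h < e" using split[of t r] s(1) s(2)[of t r] by linarith
  qed
qed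

section \<open>The damped flow in H\<close>

text \<open>The problem as seen from \<open>H\<close>: \<open>x\<close> is the image of the
  solution, \<open>y\<close> and \<open>z\<close> are its first two derivatives,
  \<open>\<phi>\<close> is the excess of the potential over its minimum, and
  \<open>z t + \<gamma> t *\<^sub>R y t - g t\<close> stands for minus the gradient. The clauses of
  \<open>flow\<close> are the chain rule, convexity tested at 0, and convexity with evenness tested
  at minus the state at time \<open>s\<close>. The power \<open>\<alpha> - 2\<close> in
  \<open>source\<close>, integrable because \<alpha> < 1, absorbs errors from differentiating the
  weights.\<close>

locale even_damped_flow =
  fixes \<alpha> K t\<^sub>0 :: real
    and \<gamma> \<theta> \<delta> \<phi> :: "real \<Rightarrow> real"
    and g x y z :: "real \<Rightarrow> 'h::real_inner"
  assumes \<alpha>: "0 \<le> \<alpha>" "\<alpha> < 1" and K: "0 < K" and t\<^sub>0: "0 \<le> t\<^sub>0"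
    and \<theta>_eq: "\<And>t. \<theta> t = (1 + t) powr \<alpha> * \<gamma> t"
    and \<theta>_ge: "\<And>t. t\<^sub>0 \<le> t \<Longrightarrow> K \<le> \<theta> t"
    and ac: "\<And>a b. 0 \<le> a \<Longrightarrow> ac_on a b x" "\<And>a b. 0 \<le> a \<Longrightarrow> ac_on a b y"
      "\<And>a b. 0 \<le> a \<Longrightarrow> ac_on a b \<theta>" "\<And>a b. 0 \<le> a \<Longrightarrow> ac_on a b \<phi>"
    and \<phi>_nonneg: "\<And>t. 0 \<le> \<phi> t"
    and derivs: "AE t in lebesgue. t\<^sub>0 < t \<longrightarrow> (x has_vector_derivative y t) (at t) \<and>
      (y has_vector_derivative z t) (at t) \<and> (\<theta> has_real_derivative \<delta> t) (at t) \<and> \<delta> t \<le> 0"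
    and flow: "AE t in lebesgue. t\<^sub>0 < t \<longrightarrow>
      (\<phi> has_real_derivative - inner (z t + \<gamma> t *\<^sub>R y t - g t) (y t)) (at t) \<and>
      inner (z t + \<gamma> t *\<^sub>R y t - g t) (x t) \<le> - \<phi> t \<and>
      (\<forall>s\<ge>0. inner (z t + \<gamma> t *\<^sub>R y t - g t) (x t + x s) \<le> \<phi> s - \<phi> t)"
    and source: "(\<lambda>t. (1 + t) powr \<alpha> * norm (g t) + (1 + t) powr (2 * \<alpha> + 1) * (norm (g t))\<^sup>2
      + (1 + t) powr (\<alpha> - 2)) integrable_on {0..}"
begin

section \<open>Weights, energy and regular times\<close>

definition w where "w t = 1 + t" for t :: real
definition A where "A t = (1 + t) powr \<alpha>" for t
definition B where "B t = (1 + t) powr (\<alpha> - 1)" for t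
definition C where "C t = (1 + t) powr (\<alpha> - 2)" for t
text \<open>Collects every integrable error; \<open>w t * (A t)\<^sup>2\<close> is the weight with
  exponent \<open>2 * \<alpha> + 1\<close>.\<close>

definition G where "G t = A t * norm (g t) + w t * (A t)\<^sup>2 * (norm (g t))\<^sup>2 + C t" for t
definition p where "p t = (norm (x t))\<^sup>2 / 2" for t
definition E where "E t = (norm (y t))\<^sup>2 / 2 + \<phi> t" for t
text \<open>The dissipation rate: the quantity whose integral the Lyapunov function \<open>W\<close>
  bounds.\<close>

definition D where "D t = A t * E t + w t * (norm (y t))\<^sup>2" for t

lemma weights:
  assumes "0 \<le> t"
  shows "1 \<le> w t" "0 < A t" "0 < B t" "0 < C t" "A t = w t * B t" "B t = w t * C t" "B t \<le> 1" "A t \<le> w t"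
proof -
  show "1 \<le> w t" "0 < A t" "0 < B t" "0 < C t" using assms by (auto simp: w_def A_def B_def C_def)
  show 1: "A t = w t * B t" "B t = w t * C t"
    using assms powr_add[of "1 + t" 1 "\<alpha> - 1"] powr_add[of "1 + t" 1 "\<alpha> - 2"]
    by (auto simp: A_def B_def C_def w_def)
  show B: "B t \<le> 1" using assms \<alpha> powr_mono[of "\<alpha> - 1" 0 "1 + t"] by (simp add: B_def)
  show "A t \<le> w t" using 1 B assms by (simp add: w_def mult_left_le)
qed

lemma weight_derivs:
  assumes "0 \<le> t"
  shows "(w has_real_derivative 1) (at t)" "(A has_real_derivative \<alpha> * B t) (at t)"
    "(B has_real_derivative (\<alpha> - 1) * C t) (at t)"
  using assms by (auto simp: A_def[abs_def] B_def[abs_def] C_def w_def[abs_def] intro!: derivative_eq_intros)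

lemma E_nonneg: "0 \<le> E t" and D_nonneg: "0 \<le> t \<Longrightarrow> 0 \<le> D t" and p_nonneg: "0 \<le> p t"
  and G_nonneg: "0 \<le> t \<Longrightarrow> 0 \<le> G t"
  using \<phi>_nonneg weights[of t] by (auto simp: E_def D_def p_def G_def intro!: add_nonneg_nonneg mult_nonneg_nonneg)

lemma G_bounds:
  assumes "0 \<le> t"
  shows "A t * norm (g t) \<le> G t" "w t * (A t)\<^sup>2 * (norm (g t))\<^sup>2 \<le> G t" "C t \<le> G t"
proof -
  have "0 \<le> A t * norm (g t)" "0 \<le> w t * (A t)\<^sup>2 * (norm (g t))\<^sup>2" "0 \<le> C t"
    using weights[OF assms] by auto
  then show "A t * norm (g t) \<le> G t" "w t * (A t)\<^sup>2 * (norm (g t))\<^sup>2 \<le> G t" "C t \<le> G t"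
    by (auto simp: G_def)
qed

lemma G_integrable: "G integrable_on {0..}"
proof (rule integrable_eq[OF source])
  fix t :: real assume "t \<in> {0..}"
  then have "(1 + t) powr (2 * \<alpha> + 1) = w t * (A t)\<^sup>2"
    using powr_add[of "1 + t" "\<alpha> + \<alpha>" 1] powr_add[of "1 + t" \<alpha> \<alpha>]
    by (simp add: w_def A_def power2_eq_square)
  then show "(1 + t) powr \<alpha> * norm (g t) + (1 + t) powr (2 * \<alpha> + 1) * (norm (g t))\<^sup>2 + (1 + t) powr (\<alpha> - 2) = G t"
    by (simp add: G_def A_def C_def)
qed

lemma G_integrable_on: "0 \<le> a \<Longrightarrow> G integrable_on {a..b}"
  by (rule integrable_on_subinterval[OF G_integrable]) auto

lemma ac_weights:
  assumes "0 \<le> a"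
  shows "ac_on a b A" "ac_on a b B" "ac_on a b w"
proof -
  show "ac_on a b A" "ac_on a b B"
    using ac_on_powr[OF assms] by (simp_all add: A_def[abs_def] B_def[abs_def])
  show "ac_on a b w"
    unfolding w_def[abs_def] by (rule ac_on_C1[where Z' = "\<lambda>_. 1"]) (auto intro!: derivative_eq_intros)
qed

lemma ac_p: "0 \<le> a \<Longrightarrow> ac_on a b p"
  and ac_E: "0 \<le> a \<Longrightarrow> ac_on a b E"
proof -
  have eqs: "p = (\<lambda>t. inner (x t) (x t) * (1/2))" "E = (\<lambda>t. inner (y t) (y t) * (1/2) + \<phi> t)"
    by (auto simp: p_def E_def power2_norm_eq_inner)
  show "0 \<le> a \<Longrightarrow> ac_on a b p" "0 \<le> a \<Longrightarrow> ac_on a b E"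
    unfolding eqs by (intro ac_on_add ac_on_mult ac_on_inner ac_on_const ac; simp)+
qed

lemma D_integrable_on: "0 \<le> a \<Longrightarrow> D integrable_on {a..b}"
  unfolding D_def[abs_def]
  by (intro integrable_continuous_real continuous_intros ac_on_continuous ac ac_E ac_weights)

text \<open>Gathers the almost-everywhere facts at one time, so that derivatives are computed
  pointwise and null sets enter only in \<open>increment\<close>. In the derivative of
  \<open>E\<close> the acceleration cancels, leaving the work of the source and the damping
  loss.\<close>

definition regular where "regular t \<longleftrightarrow> (x has_vector_derivative y t) (at t) \<and>
      (y has_vector_derivative z t) (at t) \<and> (\<theta> has_real_derivative \<delta> t) (at t) \<and> \<delta> t \<le> 0 \<and>
      (E has_real_derivative inner (g t) (y t) - \<gamma> t * (norm (y t))\<^sup>2) (at t) \<and>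
      inner (z t + \<gamma> t *\<^sub>R y t) (x t) \<le> inner (g t) (x t) - \<phi> t \<and>
      (\<forall>s\<ge>0. inner (z t + \<gamma> t *\<^sub>R y t) (x t + x s) \<le> inner (g t) (x t + x s) + \<phi> s - \<phi> t)"

lemma AE_regular: "AE t in lebesgue. t\<^sub>0 < t \<longrightarrow> regular t"
  using derivs flow
proof eventually_elim
  case (elim t)
  show ?case
  proof
    assume "t\<^sub>0 < t"
    with elim have d: "(x has_vector_derivative y t) (at t)" "(y has_vector_derivative z t) (at t)"
      "(\<theta> has_real_derivative \<delta> t) (at t)" "\<delta> t \<le> 0"
      and f: "(\<phi> has_real_derivative - inner (z t + \<gamma> t *\<^sub>R y t - g t) (y t)) (at t)"
      "inner (z t + \<gamma> t *\<^sub>R y t - g t) (x t) \<le> - \<phi> t"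
      "\<And>s. s \<ge> 0 \<Longrightarrow> inner (z t + \<gamma> t *\<^sub>R y t - g t) (x t + x s) \<le> \<phi> s - \<phi> t" by auto
    have "E = (\<lambda>t. inner (y t) (y t) / 2 + \<phi> t)" by (auto simp: E_def power2_norm_eq_inner)
    then have "(E has_real_derivative inner (g t) (y t) - \<gamma> t * (norm (y t))\<^sup>2) (at t)"
      using DERIV_add[OF DERIV_cdivide[OF inner_has_real_derivative[OF d(2,2)], of 2] f(1)]
      by (simp add: inner_commute[of "y t" "z t"] inner_diff_left inner_add_left power2_norm_eq_inner)
    moreover have "inner (z t + \<gamma> t *\<^sub>R y t) (x t + x s) \<le> inner (g t) (x t + x s) + \<phi> s - \<phi> t" if "s \<ge> 0" for s
      using f(3)[OF that] by (simp only: inner_diff_left)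
    moreover have "inner (z t + \<gamma> t *\<^sub>R y t) (x t) \<le> inner (g t) (x t) - \<phi> t"
      using f(2) by (simp only: inner_diff_left)
    ultimately show "regular t" using d by (simp add: regular_def)
  qed
qed

lemma increment:
  assumes "ac_on a b Z" "t\<^sub>0 \<le> a" "a \<le> b" "h integrable_on {a..b}"
    and "\<And>t. a < t \<Longrightarrow> t < b \<Longrightarrow> regular t \<Longrightarrow> \<exists>d\<le>h t. (Z has_real_derivative d) (at t)"
  shows "Z b - Z a \<le> integral {a..b} h"
proof (rule ac_on_increment[OF assms(1,3,4)])
  show "AE t in lebesgue. a < t \<longrightarrow> t < b \<longrightarrow> (\<exists>d\<le>h t. (Z has_real_derivative d) (at t))"
    using AE_regular by eventually_elim (use assms(2,5) in auto)
qed

lemma G_tail_small: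
  assumes "0 < e"
  obtains s where "0 \<le> s" "\<And>t r. s \<le> t \<Longrightarrow> t \<le> r \<Longrightarrow> integral {t..r} G < e"
  by (rule integral_tail_small[of G 0 "integral {0..} G" e])
    (use assms G_integrable G_integrable_on G_nonneg in \<open>auto intro!: integral_subset_le\<close>)

lemma B_small:
  assumes "0 < e"
  obtains s where "0 \<le> s" "\<And>t. s \<le> t \<Longrightarrow> B t \<le> e"
proof -
  have "(B \<longlongrightarrow> 0) at_top"
    unfolding B_def[abs_def] using \<alpha>
    by (intro tendsto_neg_powr filterlim_tendsto_add_at_top[OF tendsto_const] filterlim_ident) auto
  then have "eventually (\<lambda>t. B t < e) at_top" using assms by (rule order_tendstoD)
  then obtain s where "\<And>t. s \<le> t \<Longrightarrow> B t < e" by (auto simp: eventually_at_top_linorder)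
  then show thesis by (intro that[of "max s 0"]) (auto intro: less_imp_le)
qed

text \<open>The last term of the Lyapunov function \<open>W\<close> is chosen such that the products \<open>inner (y t) (x t)\<close> that
  are left over from the other terms cancel under differentiation.\<close>

definition W where
  "W t = 1/4 * (w t * A t * E t) + A t * inner (y t) (x t) + (\<theta> t - \<alpha> * B t) * p t"

lemma p_deriv: "regular t \<Longrightarrow> (p has_real_derivative inner (y t) (x t)) (at t)"
proof -
  assume "regular t"
  then have x: "(x has_vector_derivative y t) (at t)" by (simp add: regular_def)
  have "p = (\<lambda>t. inner (x t) (x t) / 2)" by (auto simp: p_def power2_norm_eq_inner)
  then show ?thesis
    using DERIV_cdivide[OF inner_has_real_derivative[OF x x], of 2] by (simp add: inner_commute[of "x t" "y t"])
qed

text \<open>The balance behind the constants: the growth of the weight costs at most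
  \<open>1/2\<close> of \<open>A t * E t\<close>, convexity at 0 returns a full one. Of
  \<open>K * (w t * (norm (y t))\<^sup>2)\<close> the damping returns \<open>1/4\<close>, while the
  source term and, thanks to the bound on \<open>B t\<close>, the term
  \<open>3/2 * (A t * n\<^sup>2)\<close> each cost \<open>1/16\<close>; this leaves
  \<open>1/8\<close>. What remains carries \<open>G\<close>.\<close>

lemma W_deriv:
  assumes t: "t\<^sub>0 \<le> t" and reg: "regular t" and B: "B t \<le> K / 24"
  shows "\<exists>d \<le> (1 + 1 / (4 * K) + p t) * G t - (1/2 * (A t * E t) + K / 8 * (w t * (norm (y t))\<^sup>2)).
    (W has_real_derivative d) (at t)"
proof -
  have t0: "0 \<le> t" using t t\<^sub>0 by simp
  note wt = weights[OF t0]
  define n where "n = norm (y t)"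
  have dy: "(y has_vector_derivative z t) (at t)" "(x has_vector_derivative y t) (at t)"
    and dE: "(E has_real_derivative inner (g t) (y t) - \<gamma> t * n\<^sup>2) (at t)"
    and d\<theta>: "(\<theta> has_real_derivative \<delta> t) (at t)" "\<delta> t \<le> 0"
    and zx: "inner (z t) (x t) + \<gamma> t * inner (y t) (x t) \<le> inner (g t) (x t) - \<phi> t"
    using reg by (auto simp: regular_def n_def inner_add_left)
  note dyx = inner_has_real_derivative[OF dy] and dw = weight_derivs[OF t0]
  define d where "d = 1/4 * ((A t + w t * (\<alpha> * B t)) * E t + w t * A t * (inner (g t) (y t) - \<gamma> t * n\<^sup>2))
    + (\<alpha> * B t * inner (y t) (x t) + A t * (inner (z t) (x t) + n\<^sup>2))
    + ((\<delta> t - \<alpha> * ((\<alpha> - 1) * C t)) * p t + (\<theta> t - \<alpha> * B t) * inner (y t) (x t))"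
  have "(W has_real_derivative d) (at t)"
    unfolding W_def[abs_def]
    by (rule DERIV_cong[OF DERIV_add[OF DERIV_add[OF
          DERIV_cmult[OF DERIV_mult[OF DERIV_mult[OF dw(1,2)] dE], of "1/4"] DERIV_mult[OF dw(2) dyx]]
          DERIV_mult[OF DERIV_diff[OF d\<theta>(1) DERIV_cmult[OF dw(3), of \<alpha>]] p_deriv[OF reg]]]])
      (simp add: d_def n_def power2_norm_eq_inner algebra_simps)
  moreover have "d \<le> (1 + 1 / (4 * K) + p t) * G t - (1/2 * (A t * E t) + K / 8 * (w t * n\<^sup>2))"
  proof -
    have "\<theta> t = A t * \<gamma> t" using \<theta>_eq by (simp add: A_def)
    then have "d = 1/4 * ((1 + \<alpha>) * (A t * E t)) + 1/4 * (w t * A t * inner (g t) (y t)) - 1/4 * (\<theta> t * (w t * n\<^sup>2))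
        + A t * (inner (z t) (x t) + \<gamma> t * inner (y t) (x t) + n\<^sup>2) + \<delta> t * p t + \<alpha> * (1 - \<alpha>) * (C t * p t)"
      unfolding d_def wt(5) by (simp add: algebra_simps)
    moreover have "(1 + \<alpha>) * (A t * E t) \<le> 2 * (A t * E t)"
      using \<alpha> wt E_nonneg by (intro mult_right_mono) auto
    moreover have "w t * A t * inner (g t) (y t) 
        \<le> 1/4 * (K * (w t * n\<^sup>2)) + 4 * (1 / (4 * K) * (w t * (A t)\<^sup>2 * (norm (g t))\<^sup>2))"
    proof -
      have "w t * A t * inner (g t) (y t) \<le> w t * A t * (norm (g t) * n)"
        using wt by (intro mult_left_mono) (auto simp: n_def norm_cauchy_schwarz)
      also have "\<dots> = w t * (n * (A t * norm (g t)))" by simp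
      also have "\<dots> \<le> w t * (K / 4 * n\<^sup>2 + 1 / K * (A t * norm (g t))\<^sup>2)"
        using K wt by (intro mult_left_mono mult_le_weighted_squares) auto
      finally show ?thesis by (simp add: algebra_simps power_mult_distrib)
    qed
    moreover have "K * (w t * n\<^sup>2) \<le> \<theta> t * (w t * n\<^sup>2)"
      using wt \<theta>_ge[OF t] by (intro mult_right_mono) auto
    moreover have "A t * (inner (z t) (x t) + \<gamma> t * inner (y t) (x t) + n\<^sup>2)
        \<le> A t * norm (g t) * (1 + p t) - A t * E t + 3/2 * (A t * n\<^sup>2)"
    proof -
      have "norm (x t) * 1 \<le> 1/2 * (norm (x t))\<^sup>2 + 1/2 * 1\<^sup>2"
        by (rule mult_le_weighted_squares) auto
      then have "norm (x t) \<le> 1 + p t" by (simp add: p_def)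
      then have "inner (g t) (x t) \<le> norm (g t) * (1 + p t)"
        by (intro order_trans[OF norm_cauchy_schwarz] mult_left_mono) auto
      then have "inner (z t) (x t) + \<gamma> t * inner (y t) (x t) + n\<^sup>2 \<le> norm (g t) * (1 + p t) - E t + 3/2 * n\<^sup>2"
        using zx by (simp add: E_def n_def)
      then have "A t * (inner (z t) (x t) + \<gamma> t * inner (y t) (x t) + n\<^sup>2)
        \<le> A t * (norm (g t) * (1 + p t) - E t + 3/2 * n\<^sup>2)"
        using wt by (intro mult_left_mono) auto
      then show ?thesis by (simp add: algebra_simps)
    qed
    moreover have "A t * n\<^sup>2 \<le> 1/24 * (K * (w t * n\<^sup>2))"
    proof -
      have "A t \<le> w t * (K / 24)" unfolding wt(5) using B wt by (intro mult_left_mono) auto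
      then have "A t * n\<^sup>2 \<le> w t * (K / 24) * n\<^sup>2" by (intro mult_right_mono) auto
      then show ?thesis by (simp add: algebra_simps)
    qed
    moreover have "\<delta> t * p t \<le> 0" using d\<theta>(2) p_nonneg by (intro mult_nonpos_nonneg)
    moreover have "\<alpha> * (1 - \<alpha>) * (C t * p t) \<le> C t * p t"
      using \<alpha> wt p_nonneg[of t] by (intro mult_left_le_one_le mult_le_one) auto
    moreover have "A t * norm (g t) * (1 + p t) + 1 / (4 * K) * (w t * (A t)\<^sup>2 * (norm (g t))\<^sup>2) + C t * p t
        \<le> (1 + 1 / (4 * K) + p t) * G t"
    proof -
      let ?c = "1 + 1 / (4 * K) + p t"
      have "1 + p t \<le> ?c" "1 / (4 * K) \<le> ?c" "p t \<le> ?c" using K p_nonneg[of t] by auto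
      then have "A t * norm (g t) * (1 + p t) \<le> A t * norm (g t) * ?c"
        "1 / (4 * K) * (w t * (A t)\<^sup>2 * (norm (g t))\<^sup>2) \<le> ?c * (w t * (A t)\<^sup>2 * (norm (g t))\<^sup>2)"
        "C t * p t \<le> C t * ?c"
        using wt by (intro mult_left_mono mult_right_mono; simp)+
      then show ?thesis by (simp add: G_def algebra_simps)
    qed
    moreover have "K / 8 * (w t * n\<^sup>2) = 1/8 * (K * (w t * n\<^sup>2))" by simp
    ultimately show ?thesis by linarith
  qed
  ultimately show ?thesis by (intro exI[of _ d]) (simp add: n_def)
qed

text \<open>The mixed term of \<open>W\<close> is split by Young. As
  \<open>A t \<le> w t * (K / 24)\<close>, its velocity part costs at most \<open>1/12\<close> of
  \<open>w t * A t * E t\<close>, leaving more than \<open>1/8\<close> out of \<open>1/4\<close>.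
  Its position part costs \<open>K / 2 * p t\<close> out of the \<open>3/4 * K * p t\<close> that
  the last summand supplies.\<close>

lemma W_lower:
  assumes t: "t\<^sub>0 \<le> t" and B: "B t \<le> K / 24"
  shows "1/8 * (w t * A t * E t) + K / 4 * p t \<le> W t"
proof -
  have t0: "0 \<le> t" using t t\<^sub>0 by simp
  note wt = weights[OF t0]
  define n where "n = norm (y t)"
  have "\<bar>inner (y t) (x t)\<bar> \<le> n * norm (x t)" by (simp add: n_def Cauchy_Schwarz_ineq2)
  then have "- (A t * inner (y t) (x t)) \<le> A t * (n * norm (x t))"
    unfolding mult_minus_right[symmetric] using wt by (intro mult_left_mono) auto
  also have "\<dots> = (A t * n) * norm (x t)" by simp
  also have "\<dots> \<le> 1 / K * (A t * n)\<^sup>2 + K / 4 * (norm (x t))\<^sup>2"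
    using K by (intro mult_le_weighted_squares) auto
  also have "\<dots> = 1 / K * (A t * (A t * n\<^sup>2)) + K / 2 * p t" by (simp add: p_def power2_eq_square algebra_simps)
  also have "1 / K * (A t * (A t * n\<^sup>2)) \<le> 1 / K * (w t * (K / 24) * (A t * n\<^sup>2))"
  proof (intro mult_left_mono mult_right_mono)
    show "A t \<le> w t * (K / 24)" unfolding wt(5) using B wt by (intro mult_left_mono) auto
  qed (use wt K in auto)
  also have "\<dots> = 1/24 * (w t * A t * n\<^sup>2)" using K by simp
  finally have "- (A t * inner (y t) (x t)) \<le> 1/24 * (w t * A t * n\<^sup>2) + K / 2 * p t"
    by simp
  moreover have "w t * A t * (1/2 * n\<^sup>2) \<le> w t * A t * E t"
    using wt \<phi>_nonneg by (intro mult_left_mono) (auto simp: E_def n_def)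
  moreover have "3/4 * K * p t \<le> (\<theta> t - \<alpha> * B t) * p t"
  proof (intro mult_right_mono p_nonneg)
    have "\<alpha> * B t \<le> 1 * B t" using \<alpha> wt by (intro mult_right_mono) auto
    then show "3/4 * K \<le> \<theta> t - \<alpha> * B t" using B \<theta>_ge[OF t] K by simp
  qed
  moreover have "0 \<le> w t * A t * E t" using wt E_nonneg by simp
  moreover have "0 \<le> K * p t" using K p_nonneg by simp
  ultimately show ?thesis by (simp add: W_def)
qed

text \<open>Gronwall's argument without exponentials: beyond \<open>T\<close> the integral of \<open>G\<close> is so small that its product
  with the maximum of \<open>p\<close> is absorbed.\<close>

lemma lyapunov_bounds:
  obtains T c where "t\<^sub>0 \<le> T" "0 \<le> c" "\<And>t. T \<le> t \<Longrightarrow> p t \<le> c" "\<And>t. T \<le> t \<Longrightarrow> integral {T..t} D \<le> c"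
proof -
  define k where "k = 1 + 1 / (4 * K)"
  obtain s1 where s1: "0 \<le> s1" "\<And>t. s1 \<le> t \<Longrightarrow> B t \<le> K / 24" using B_small[of "K / 24"] K by auto
  \<comment> \<open>Half of the coefficient \<open>K / 4\<close> in \<open>W_lower\<close>, so that
    the term with \<open>p\<close> coming from \<open>G\<close> can be absorbed.\<close>
  obtain s2 where s2: "0 \<le> s2" "\<And>t r. s2 \<le> t \<Longrightarrow> t \<le> r \<Longrightarrow> integral {t..r} G < K / 8"
    using G_tail_small[of "K / 8"] K by auto
  define T where "T = max t\<^sub>0 (max s1 s2)"
  have T: "t\<^sub>0 \<le> T" "s1 \<le> T" "s2 \<le> T" "0 \<le> T" using t\<^sub>0 by (auto simp: T_def)
  define \<kappa> where "\<kappa> = min (1/2) (K / 8)"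
  have \<kappa>: "0 < \<kappa>" "\<kappa> \<le> 1/2" "\<kappa> \<le> K / 8" using K by (auto simp: \<kappa>_def)
  \<comment> \<open>\<open>P\<close> is an arbitrary bound for \<open>p\<close> up to
    \<open>r\<close>. The estimate is used twice: with \<open>P\<close> the maximum of
    \<open>p\<close>, to find a bound independent of \<open>r\<close>, and then with that
    bound.\<close>
  have step: "W r + \<kappa> * integral {T..r} D \<le> W T + (k + P) * (K / 8)"
    if r: "T \<le> r" and P: "0 \<le> P" "\<And>t. T \<le> t \<Longrightarrow> t \<le> r \<Longrightarrow> p t \<le> P" for r P
  proof -
    have "W r - W T \<le> integral {T..r} (\<lambda>t. (k + P) * G t - \<kappa> * D t)"
    proof (rule increment[OF _ T(1) r])
      have "W = (\<lambda>t. 1/4 * (w t * A t * E t) + A t * inner (y t) (x t) + (\<theta> t - \<alpha> * B t) * p t)"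
        by (simp add: W_def[abs_def])
      then show "ac_on T r W"
        using T(4) by (simp only:) (intro ac_on_add ac_on_diff ac_on_mult ac_on_inner ac_on_const ac ac_weights ac_E ac_p)
      show "(\<lambda>t. (k + P) * G t - \<kappa> * D t) integrable_on {T..r}"
        using T(4) by (intro integrable_diff integrable_on_mult_right G_integrable_on D_integrable_on)
      fix t assume t: "T < t" "t < r" "regular t"
      then obtain d where d: "d \<le> (k + p t) * G t - (1/2 * (A t * E t) + K / 8 * (w t * (norm (y t))\<^sup>2))"
        "(W has_real_derivative d) (at t)"
        using W_deriv[of t] T s1(2)[of t] by (auto simp: k_def)
      have t0: "0 \<le> t" using t T by simp
      have "(k + p t) * G t \<le> (k + P) * G t"
        using P(2)[of t] t G_nonneg[OF t0] by (intro mult_right_mono) auto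
      moreover have "\<kappa> * (A t * E t) \<le> 1/2 * (A t * E t)"
        using \<kappa> weights[OF t0] E_nonneg by (intro mult_right_mono) auto
      moreover have "\<kappa> * (w t * (norm (y t))\<^sup>2) \<le> K / 8 * (w t * (norm (y t))\<^sup>2)"
        using \<kappa> weights[OF t0] by (intro mult_right_mono) auto
      ultimately have "d \<le> (k + P) * G t - \<kappa> * D t"
        using d(1) unfolding D_def distrib_left by linarith
      then show "\<exists>d\<le>(k + P) * G t - \<kappa> * D t. (W has_real_derivative d) (at t)" using d(2) by auto
    qed
    also have "\<dots> = (k + P) * integral {T..r} G - \<kappa> * integral {T..r} D"
      using G_integrable_on[OF T(4), of r] D_integrable_on[OF T(4), of r]
      by (subst Henstock_Kurzweil_Integration.integral_diff) (auto intro: integrable_on_mult_right)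
    also have "(k + P) * integral {T..r} G \<le> (k + P) * (K / 8)"
      using s2(2)[OF T(3) r] K P(1) by (intro mult_left_mono) (auto simp: k_def)
    finally show ?thesis by simp
  qed
  have D0: "0 \<le> integral {T..r} D" for r
    using T(4) by (intro integral_nonneg D_integrable_on D_nonneg) auto
  have W0: "0 \<le> W t" "K / 4 * p t \<le> W t" if "T \<le> t" for t
  proof -
    have "t\<^sub>0 \<le> t" "0 \<le> t" using that T by auto
    with W_lower[of t] s1(2)[of t] that T weights[of t] E_nonneg[of t] p_nonneg[of t] K
    have "1/8 * (w t * A t * E t) + K / 4 * p t \<le> W t" "0 \<le> w t * A t * E t" "0 \<le> K / 4 * p t" by auto
    then show "0 \<le> W t" "K / 4 * p t \<le> W t" by linarith+
  qed
  \<comment> \<open>The solution of \<open>K / 4 * P = W T + (k + P) * (K / 8)\<close>.\<close>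
  define P0 where "P0 = 8 / K * W T + k"
  have P0: "0 \<le> P0" using W0(1)[of T] K by (simp add: P0_def k_def)
  have p: "p r \<le> P0" if r: "T \<le> r" for r
  proof -
    have "continuous_on {T..r} p" using ac_on_continuous[OF ac_p[OF T(4)]] .
    then obtain s where s: "s \<in> {T..r}" "\<And>t. t \<in> {T..r} \<Longrightarrow> p t \<le> p s"
      using continuous_attains_sup[of "{T..r}" p] r by auto
    have "W s + \<kappa> * integral {T..s} D \<le> W T + (k + p s) * (K / 8)"
      by (rule step) (use s p_nonneg in auto)
    moreover have "0 \<le> \<kappa> * integral {T..s} D" using D0 \<kappa> by simp
    moreover have "K / 4 * p s \<le> W s" using W0(2) s(1) by simp
    ultimately have "K / 4 * p s \<le> W T + (k + p s) * (K / 8)"  by linarith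
    then have "p s \<le> P0" using K by (simp add: P0_def field_simps)
    then show ?thesis using s(2)[of r] r by simp
  qed
  define c where "c = max P0 ((W T + (k + P0) * (K / 8)) / \<kappa>)"
  have "integral {T..t} D \<le> c" if t: "T \<le> t" for t
  proof -
    have "\<kappa> * integral {T..t} D \<le> W T + (k + P0) * (K / 8)"
      using step[OF t P0] p W0(1)[OF t] by fastforce
    then have "integral {T..t} D \<le> (W T + (k + P0) * (K / 8)) / \<kappa>"
      using \<kappa> by (simp add: pos_le_divide_eq mult.commute)
    then show ?thesis by (simp add: c_def)
  qed
  moreover have "p t \<le> c" if "T \<le> t" for t using p[OF that] by (simp add: c_def)
  moreover have "0 \<le> c" using P0 by (simp add: c_def)
  ultimately show thesis using T(1) that by blast
qed

lemma D_tail_small: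
  assumes "0 < e"
  obtains s where "t\<^sub>0 \<le> s" "\<And>t r. s \<le> t \<Longrightarrow> t \<le> r \<Longrightarrow> integral {t..r} D < e"
proof -
  obtain T c where T: "t\<^sub>0 \<le> T" "\<And>t. T \<le> t \<Longrightarrow> integral {T..t} D \<le> c"
    using lyapunov_bounds by metis
  have T0: "0 \<le> T" using T t\<^sub>0 by simp
  obtain s where "T \<le> s" "\<And>t r. s \<le> t \<Longrightarrow> t \<le> r \<Longrightarrow> integral {t..r} D < e"
    using integral_tail_small[of D T c e, OF D_integrable_on[OF T0] D_nonneg T(2) assms] T0
    by (metis order_trans)
  then show thesis using T(1) that by (meson order_trans)
qed

section \<open>Decay of the weighted energy and velocity\<close>

definition V where "V t = w t * A t * E t"

text \<open>The growth of the weight is paid by \<open>2 * D t\<close>, and Young's inequality hides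
  the velocity part of the source term in the damping loss. Since \<open>D\<close> and
  \<open>G\<close> have small tails, \<open>V\<close> can hardly increase at late times.\<close>

lemma V_deriv:
  assumes t: "t\<^sub>0 \<le> t" and reg: "regular t"
  shows "\<exists>d \<le> 2 * D t + 1 / (4 * K) * G t. (V has_real_derivative d) (at t)"
proof -
  have t0: "0 \<le> t" using t t\<^sub>0 by simp
  note wt = weights[OF t0] and dw = weight_derivs[OF t0]
  define n where "n = norm (y t)"
  have dE: "(E has_real_derivative inner (g t) (y t) - \<gamma> t * n\<^sup>2) (at t)"
    using reg by (auto simp: regular_def n_def)
  define d where "d = (A t + w t * (\<alpha> * B t)) * E t + w t * A t * (inner (g t) (y t) - \<gamma> t * n\<^sup>2)"
  have "(V has_real_derivative d) (at t)"
    unfolding V_def[abs_def]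
    by (rule DERIV_cong[OF DERIV_mult[OF DERIV_mult[OF dw(1,2)] dE]]) (simp add: d_def algebra_simps)
  moreover have "d \<le> 2 * D t + 1 / (4 * K) * G t"
  proof -
    have "\<theta> t = A t * \<gamma> t" using \<theta>_eq by (simp add: A_def)
    then have "d = (1 + \<alpha>) * (A t * E t) + w t * A t * inner (g t) (y t) - \<theta> t * (w t * n\<^sup>2)"
      unfolding d_def wt(5) by (simp add: algebra_simps)
    moreover have "(1 + \<alpha>) * (A t * E t) \<le> 2 * (A t * E t)"
      using \<alpha> wt E_nonneg by (intro mult_right_mono) auto
    moreover have "w t * A t * inner (g t) (y t) \<le> K * (w t * n\<^sup>2) + 1 / (4 * K) * (w t * (A t)\<^sup>2 * (norm (g t))\<^sup>2)"
    proof -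
      have "w t * A t * inner (g t) (y t) \<le> w t * A t * (norm (g t) * n)"
        using wt by (intro mult_left_mono) (auto simp: n_def norm_cauchy_schwarz)
      also have "\<dots> = w t * (n * (A t * norm (g t)))" by simp
      also have "\<dots> \<le> w t * (K * n\<^sup>2 + 1 / (4 * K) * (A t * norm (g t))\<^sup>2)"
        using K wt by (intro mult_left_mono mult_le_weighted_squares) auto
      finally show ?thesis by (simp add: algebra_simps power_mult_distrib)
    qed
    moreover have "K * (w t * n\<^sup>2) \<le> \<theta> t * (w t * n\<^sup>2)"
      using wt \<theta>_ge[OF t] by (intro mult_right_mono) auto
    moreover have "1 / (4 * K) * (w t * (A t)\<^sup>2 * (norm (g t))\<^sup>2) \<le> 1 / (4 * K) * G t"
      using K G_bounds[OF t0] by (intro mult_left_mono) auto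
    moreover have "A t * E t \<le> D t" using wt by (simp add: D_def)
    ultimately show ?thesis by linarith
  qed
  ultimately show ?thesis by blast
qed

text \<open>\<open>D\<close> dominates \<open>V t / w t\<close>, and \<open>1 / w t\<close> is not
  integrable, so \<open>V\<close> must drop below \<open>e / 2\<close> at some late time. From then
  on \<open>V_deriv\<close> prevents it from regaining more than \<open>e / 2\<close>: the two tails
  contribute \<open>e / 4\<close> each.\<close>

lemma V_small:
  assumes e: "0 < e"
  obtains s where "t\<^sub>0 \<le> s" "\<And>t. s \<le> t \<Longrightarrow> V t < e"
proof -
  obtain s1 where s1: "t\<^sub>0 \<le> s1" "\<And>t r. s1 \<le> t \<Longrightarrow> t \<le> r \<Longrightarrow> integral {t..r} D < e / 8"
    using D_tail_small[of "e / 8"] e by auto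
  obtain s2 where s2: "0 \<le> s2" "\<And>t r. s2 \<le> t \<Longrightarrow> t \<le> r \<Longrightarrow> integral {t..r} G < e * K"
    using G_tail_small[of "e * K"] e K by auto
  define s where "s = max s1 s2"
  have s: "s1 \<le> s" "s2 \<le> s" "t\<^sub>0 \<le> s" "0 \<le> s" using s1(1) s2(1) by (auto simp: s_def)
  have "\<exists>r\<ge>s. V r < e / 2"
  proof (rule ccontr)
    assume "\<not> ?thesis"
    then have big: "e / 2 \<le> V r" if "s \<le> r" for r using that by force
    \<comment> \<open>Makes the logarithm of \<open>1 + t\<close> grow by exactly 1 between
      \<open>s\<close> and \<open>r\<close>, so the integral of \<open>D\<close> would be at least
      \<open>e / 2\<close>.\<close>
    define r where "r = exp 1 * (1 + s) - 1"
    have "1 * (1 + s) \<le> exp 1 * (1 + s)" using s(4) by (intro mult_right_mono) auto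
    then have sr: "s \<le> r" by (simp add: r_def)
    have "((\<lambda>t. e / 2 / (1 + t)) has_integral (e / 2 * ln (1 + r) - e / 2 * ln (1 + s))) {s..r}"
      using s(4) sr by (intro fundamental_theorem_of_calculus)
        (auto intro!: derivative_eq_intros simp flip: has_real_derivative_iff_has_vector_derivative simp: field_simps)
    then have "e / 2 * ln (1 + r) - e / 2 * ln (1 + s) \<le> integral {s..r} D"
    proof (rule has_integral_le[OF _ integrable_integral[OF D_integrable_on[OF s(4)]]])
      fix t assume "t \<in> {s..r}"
      then have t: "s \<le> t" "0 \<le> t" using s by auto
      note wt = weights[OF t(2)]
      have "e / 2 \<le> w t * (A t * E t)" using big[OF t(1)] by (simp add: V_def)
      then have "e / 2 / w t \<le> A t * E t" using wt by (simp add: divide_le_eq mult.commute)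
      also have "\<dots> \<le> D t" using wt by (simp add: D_def)
      finally show "e / 2 / (1 + t) \<le> D t" by (simp add: w_def)
    qed
    moreover have "ln (1 + r) = 1 + ln (1 + s)" using s(4) by (simp add: r_def ln_mult)
    ultimately have "e / 2 \<le> integral {s..r} D" by (simp add: algebra_simps)
    then show False using s1(2)[OF s(1) sr] e by simp
  qed
  then obtain r where r: "s \<le> r" "V r < e / 2" by auto
  have "V t < e" if t: "r \<le> t" for t
  proof -
    have r0: "0 \<le> r" "t\<^sub>0 \<le> r" using r s by auto
    have "V t - V r \<le> integral {r..t} (\<lambda>q. 2 * D q + 1 / (4 * K) * G q)"
    proof (rule increment[OF _ r0(2) t])
      show "ac_on r t V" unfolding V_def[abs_def] using r0 by (intro ac_on_mult ac_weights ac_E)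
      show "(\<lambda>q. 2 * D q + 1 / (4 * K) * G q) integrable_on {r..t}"
        using r0 by (intro integrable_add integrable_on_mult_right G_integrable_on D_integrable_on)
    qed (use V_deriv r0 in auto)
    also have "\<dots> = integral {r..t} (\<lambda>q. 2 * D q) + integral {r..t} (\<lambda>q. 1 / (4 * K) * G q)"
      using r0(1)
      by (intro Henstock_Kurzweil_Integration.integral_add integrable_on_mult_right G_integrable_on D_integrable_on)
    also have "\<dots> = 2 * integral {r..t} D + 1 / (4 * K) * integral {r..t} G"
      by (simp only: integral_mult_right)
    also have "2 * integral {r..t} D < 2 * (e / 8)" using s1(2)[of r t] r s t by simp
    also have "1 / (4 * K) * integral {r..t} G \<le> 1 / (4 * K) * (e * K)"
      using s2(2)[of r t] r s t K by (intro mult_left_mono) auto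
    finally show ?thesis using r(2) K by simp
  qed
  then show thesis using that[of r] r s by auto
qed

text \<open>Because \<open>A t \<le> w t\<close>, the square of \<open>A t * norm (y t)\<close> is
  at most \<open>2 * V t\<close>.\<close>

lemma norm_y_small:
  assumes e: "0 < e"
  obtains s where "t\<^sub>0 \<le> s" "\<And>t. s \<le> t \<Longrightarrow> A t * norm (y t) < e"
proof -
  obtain s where s: "t\<^sub>0 \<le> s" "\<And>t. s \<le> t \<Longrightarrow> V t < e\<^sup>2 / 2" using V_small[of "e\<^sup>2 / 2"] e by auto
  have "A t * norm (y t) < e" if t: "s \<le> t" for t
  proof -
    have t0: "0 \<le> t" using s t t\<^sub>0 by simp
    note wt = weights[OF t0]
    have "A t * (A t * (norm (y t))\<^sup>2) \<le> w t * (A t * (2 * E t))"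
      using wt \<phi>_nonneg[of t] by (intro mult_mono mult_left_mono) (auto simp: E_def)
    also have "\<dots> < e\<^sup>2" using s(2)[OF t] by (simp add: V_def algebra_simps)
    finally have "(A t * norm (y t))\<^sup>2 < e\<^sup>2" by (simp add: power2_eq_square algebra_simps)
    then show ?thesis using e by (simp add: power_less_imp_less_base)
  qed
  with s(1) that show thesis by blast
qed

text \<open>In the derivative of \<open>Y r c\<close> the energy increment \<open>E t - E r\<close> in the last summand cancels the one
  that arises from \<open>\<phi> r - \<phi> t\<close>.\<close>

definition Y where
  "Y r c t = A t * inner (y t) (x t + x r) + \<theta> t * (p t + inner (x t) (x r) - 3/2 * (norm (x r))\<^sup>2 + c)
    + 1 / (1 + \<alpha>) * (w t * A t * (E t - E r))"

text \<open>The factor \<open>1 / (1 + \<alpha>)\<close> is there because the derivative of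
  \<open>w t * A t\<close> is \<open>(1 + \<alpha>) * A t\<close>; this makes the energy increments
  cancel exactly. Every other term is bounded by \<open>D\<close> or \<open>G\<close>, with
  constants depending only on \<open>M\<close> and not on \<open>r\<close>.\<close>

lemma Y_deriv:
  assumes t: "t\<^sub>0 \<le> t" and r: "0 \<le> r" and reg: "regular t" and M: "norm (x t) \<le> M" "norm (x r) \<le> M"
  shows "\<exists>d \<le> (2 * M + 3) * (D t + G t). (Y r (3 * M\<^sup>2) has_real_derivative d) (at t)"
proof -
  have t0: "0 \<le> t" using t t\<^sub>0 by simp
  have M0: "0 \<le> M" using M(1) norm_ge_zero[of "x t"] by linarith
  note wt = weights[OF t0] and dw = weight_derivs[OF t0]
  define n where "n = norm (y t)"
  define X where "X = x t + x r"
  define q where "q = p t + inner (x t) (x r) - 3/2 * (norm (x r))\<^sup>2 + 3 * M\<^sup>2"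
  have n0: "0 \<le> n" by (simp add: n_def)
  have X: "norm X \<le> 2 * M" unfolding X_def using M norm_triangle_ineq[of "x t" "x r"] by simp
  have dy: "(y has_vector_derivative z t) (at t)" and dx: "(x has_vector_derivative y t) (at t)"
    and dE: "(E has_real_derivative inner (g t) (y t) - \<gamma> t * n\<^sup>2) (at t)"
    and d\<theta>: "(\<theta> has_real_derivative \<delta> t) (at t)" "\<delta> t \<le> 0"
    and zX: "inner (z t) X + \<gamma> t * inner (y t) X \<le> inner (g t) X + \<phi> r - \<phi> t"
    using reg r by (auto simp: regular_def n_def inner_add_left X_def)
  have dX: "((\<lambda>t. x t + x r) has_vector_derivative y t) (at t)"
    using has_vector_derivative_add[OF dx has_vector_derivative_const] by simp
  note dyX = inner_has_real_derivative[OF dy dX] and dxx = inner_has_real_derivative[OF dx has_vector_derivative_const[of "x r"]]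
  define d where "d = \<alpha> * B t * inner (y t) X + A t * (inner (z t) X + n\<^sup>2) + (\<delta> t * q + \<theta> t * inner (y t) X)
     + 1 / (1 + \<alpha>) * ((A t + w t * (\<alpha> * B t)) * (E t - E r) + w t * A t * (inner (g t) (y t) - \<gamma> t * n\<^sup>2))"
  have "(Y r (3 * M\<^sup>2) has_real_derivative d) (at t)"
    unfolding Y_def[abs_def]
    by (rule DERIV_cong[OF DERIV_add[OF DERIV_add[OF DERIV_mult[OF dw(2) dyX]
          DERIV_mult[OF d\<theta>(1) DERIV_add[OF DERIV_diff[OF DERIV_add[OF p_deriv[OF reg] dxx] DERIV_const] DERIV_const]]]
          DERIV_cmult[OF DERIV_mult[OF DERIV_mult[OF dw(1,2)] DERIV_diff[OF dE DERIV_const]]]]])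
      (simp add: d_def n_def X_def q_def power2_norm_eq_inner algebra_simps)
  moreover have "d \<le> (2 * M + 3) * (D t + G t)"
  proof -
    have "\<theta> t = A t * \<gamma> t" using \<theta>_eq by (simp add: A_def)
    moreover have "1 / (1 + \<alpha>) * ((A t + w t * (\<alpha> * B t)) * (E t - E r)) = A t * (E t - E r)"
      using \<alpha> unfolding wt(5) by (simp add: field_simps)
    ultimately have "d = \<alpha> * B t * inner (y t) X + A t * (inner (z t) X + \<gamma> t * inner (y t) X + n\<^sup>2) + \<delta> t * q
        + A t * (E t - E r) + 1 / (1 + \<alpha>) * (w t * A t * inner (g t) (y t)) - 1 / (1 + \<alpha>) * (\<theta> t * (w t * n\<^sup>2))"
      unfolding d_def distrib_left[of "1 / (1 + \<alpha>)"] by (simp add: algebra_simps)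
    \<comment> \<open>Written as \<open>w t * (n * C t)\<close>, the product \<open>n * B t\<close>
      splits into dissipation and \<open>w t * (C t)\<^sup>2 = B t * C t \<le> C t\<close>, which is
      integrable.\<close>
    moreover have "\<alpha> * B t * inner (y t) X \<le> 2 * M * (w t * n\<^sup>2) + 2 * M * C t"
    proof -
      have "\<alpha> * B t * inner (y t) X \<le> \<alpha> * B t * (n * (2 * M))"
        using \<alpha> wt X n0 unfolding n_def
        by (intro mult_left_mono order_trans[OF norm_cauchy_schwarz]) auto
      also have "\<dots> \<le> 1 * B t * (n * (2 * M))" using \<alpha> wt n0 M0 by (intro mult_right_mono) auto
      also have "\<dots> = 2 * M * (w t * (n * C t))" using wt(6) by simp
      also have "n * C t \<le> 1 * n\<^sup>2 + 1 * (C t)\<^sup>2" by (rule mult_le_weighted_squares) auto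
      also have "2 * M * (w t * (1 * n\<^sup>2 + 1 * (C t)\<^sup>2)) = 2 * M * (w t * n\<^sup>2) + 2 * M * (B t * C t)"
        using wt(6) by (simp add: power2_eq_square algebra_simps)
      also have "B t * C t \<le> 1 * C t" using wt by (intro mult_right_mono) auto
      finally show ?thesis using M0 wt by (simp add: mult_left_mono)
    qed
    moreover have "A t * (inner (z t) X + \<gamma> t * inner (y t) X + n\<^sup>2)
        \<le> 2 * M * (A t * norm (g t)) - A t * (E t - E r) + 3/2 * (A t * n\<^sup>2)"
    proof -
      have "inner (g t) X \<le> norm (g t) * (2 * M)"
        using X by (intro order_trans[OF norm_cauchy_schwarz] mult_left_mono) auto
      moreover have "\<phi> r \<le> E r" by (simp add: E_def)
      ultimately have "inner (z t) X + \<gamma> t * inner (y t) X + n\<^sup>2 \<le> norm (g t) * (2 * M) - (E t - E r) + 3/2 * n\<^sup>2"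
        using zX by (simp add: E_def[of t] n_def)
      then have "A t * (inner (z t) X + \<gamma> t * inner (y t) X + n\<^sup>2)
        \<le> A t * (norm (g t) * (2 * M) - (E t - E r) + 3/2 * n\<^sup>2)"
        using wt by (intro mult_left_mono) auto
      then show ?thesis by (simp add: algebra_simps)
    qed
    moreover have "A t * n\<^sup>2 \<le> w t * n\<^sup>2" using wt by (intro mult_right_mono) auto
    \<comment> \<open>The constant \<open>3 * M\<^sup>2\<close> is inside \<open>q\<close> to make
      it nonnegative: the two terms of indefinite or negative sign cost at most
      \<open>5/2 * M\<^sup>2\<close>.\<close>
    moreover have "\<delta> t * q \<le> 0"
    proof -
      have "\<bar>inner (x t) (x r)\<bar> \<le> M * M"
        using M M0 by (intro order_trans[OF Cauchy_Schwarz_ineq2] mult_mono) auto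
      moreover have "(norm (x r))\<^sup>2 \<le> M\<^sup>2" using M by (intro power_mono) auto
      ultimately have "0 \<le> q"
        using p_nonneg[of t] zero_le_power2[of M] unfolding q_def power2_eq_square[of M] by linarith
      then show ?thesis using d\<theta>(2) by (intro mult_nonpos_nonneg)
    qed
    moreover have "1 / (1 + \<alpha>) * (w t * A t * inner (g t) (y t)) \<le> w t * n\<^sup>2 + w t * (A t)\<^sup>2 * (norm (g t))\<^sup>2"
    proof -
      have "1 / (1 + \<alpha>) * (w t * A t * inner (g t) (y t)) \<le> 1 / (1 + \<alpha>) * (w t * A t * (norm (g t) * n))"
        using wt \<alpha> by (intro mult_left_mono) (auto simp: n_def norm_cauchy_schwarz)
      also have "\<dots> \<le> 1 * (w t * A t * (norm (g t) * n))"
        using wt \<alpha> n0 by (intro mult_right_mono) auto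
      also have "\<dots> = w t * (n * (A t * norm (g t)))" by simp
      also have "\<dots> \<le> w t * (1 * n\<^sup>2 + 1 * (A t * norm (g t))\<^sup>2)"
        using wt by (intro mult_left_mono mult_le_weighted_squares) auto
      finally show ?thesis by (simp add: algebra_simps power_mult_distrib)
    qed
    moreover have "0 \<le> 1 / (1 + \<alpha>) * (\<theta> t * (w t * n\<^sup>2))"
      using wt \<alpha> K \<theta>_ge[OF t] by auto
    moreover have "2 * M * (w t * n\<^sup>2) + 3 * (w t * n\<^sup>2) \<le> (2 * M + 3) * D t"
    proof -
      have "w t * n\<^sup>2 \<le> D t" using wt E_nonneg by (simp add: D_def n_def)
      then have "(2 * M + 3) * (w t * n\<^sup>2) \<le> (2 * M + 3) * D t" using M0 by (intro mult_left_mono) auto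
      then show ?thesis by (simp add: algebra_simps)
    qed
    moreover have "2 * M * C t + 2 * M * (A t * norm (g t)) + w t * (A t)\<^sup>2 * (norm (g t))\<^sup>2 \<le> (2 * M + 3) * G t"
    proof -
      have "2 * M * (C t + A t * norm (g t)) \<le> 2 * M * G t"
        using M0 wt by (intro mult_left_mono) (auto simp: G_def)
      moreover have "w t * (A t)\<^sup>2 * (norm (g t))\<^sup>2 \<le> G t" "0 \<le> G t" using G_bounds[OF t0] G_nonneg[OF t0] by auto
      ultimately show ?thesis unfolding distrib_left distrib_right by linarith
    qed
    moreover have "0 \<le> w t * n\<^sup>2" using wt by simp
    moreover have "(2 * M + 3) * (D t + G t) = (2 * M + 3) * D t + (2 * M + 3) * G t" by (rule distrib_left)
    ultimately show ?thesis by linarith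
  qed
  ultimately show ?thesis by blast
qed

text \<open>Integrating \<open>Y_deriv\<close> from \<open>t\<close> to \<open>r\<close> compares
  the bracket \<open>Q\<close> of \<open>Y\<close> at both times. It vanishes at \<open>r\<close>,
  and \<open>- Q t\<close> is the expression to be bounded. All other terms of \<open>Y\<close> are
  small at late times, and \<open>K \<le> \<theta> t\<close> allows division by the damping
  factor.\<close>

lemma norm_x_increment:
  assumes e: "0 < e"
  obtains s where "t\<^sub>0 \<le> s"
    "\<And>t r. s \<le> t \<Longrightarrow> t \<le> r \<Longrightarrow> (norm (x r))\<^sup>2 - (norm (x t))\<^sup>2 + (norm (x t - x r))\<^sup>2 / 2 \<le> e"
proof -
  obtain T c where T: "t\<^sub>0 \<le> T" "0 \<le> c" "\<And>t. T \<le> t \<Longrightarrow> p t \<le> c" using lyapunov_bounds by metis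
  define M where "M = sqrt (2 * c)"
  have M0: "0 \<le> M" using T by (simp add: M_def)
  have M: "norm (x t) \<le> M" if "T \<le> t" for t
    using T(3)[OF that] by (simp add: p_def M_def real_le_rsqrt)
  define c' where "c' = 3 * M\<^sup>2"
  have cancel: "a / (8 * b) * b = a / 8" if "b \<noteq> 0" for a b :: real
    using that by simp
  \<comment> \<open>Budget in units of \<open>K * e / 8\<close>: two for the integrals of
    \<open>D\<close> and \<open>G\<close>, two for the velocity terms at both ends, one for the
    weighted energy, one for the drop of \<theta>; six of eight in all. The 3 and the 1 in the
    denominators keep them positive when \<open>M = 0\<close>.\<close>
  define e1 where "e1 = K * e / (8 * (2 * M + 3))"
  have e1: "0 < e1" using e K M0 by (auto simp: e1_def intro!: divide_pos_pos)
  define e2 where "e2 = K * e / (8 * (c' + 1))"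
  have c': "0 \<le> c'" by (simp add: c'_def)
  have e2: "0 < e2" using e K c' by (auto simp: e2_def intro!: divide_pos_pos)
  \<comment> \<open>A nonincreasing function bounded below by \<open>K\<close> has small late drops,
    which controls the contribution of the constant \<open>c'\<close>.\<close>
  have \<theta>_anti: "- \<theta> t \<le> - \<theta> r" if "t\<^sub>0 \<le> t" "t \<le> r" for t r
  proof -
    have "\<theta> r - \<theta> t \<le> integral {t..r} (\<lambda>_. 0)"
      by (rule increment) (use that t\<^sub>0 ac in \<open>auto simp: regular_def\<close>)
    then show ?thesis by simp
  qed
  obtain s1 where s1: "t\<^sub>0 \<le> s1" "\<And>t r. s1 \<le> t \<Longrightarrow> t \<le> r \<Longrightarrow> integral {t..r} D < e1" using D_tail_small[OF e1] by blast
  obtain s2 where s2: "0 \<le> s2" "\<And>t r. s2 \<le> t \<Longrightarrow> t \<le> r \<Longrightarrow> integral {t..r} G < e1" using G_tail_small[OF e1] by blast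
  obtain s3 where s3: "t\<^sub>0 \<le> s3" "\<And>t. s3 \<le> t \<Longrightarrow> A t * norm (y t) < e1" using norm_y_small[OF e1] by blast
  obtain s4 where s4: "t\<^sub>0 \<le> s4" "\<And>t. s4 \<le> t \<Longrightarrow> V t < K * e / 8" using V_small[of "K * e / 8"] e K by auto
  have "\<And>t. t\<^sub>0 \<le> t \<Longrightarrow> - \<theta> t \<le> - K" using \<theta>_ge by simp
  from incseq_bounded_increments_small[of t\<^sub>0 "\<lambda>t. - \<theta> t", OF \<theta>_anti this e2]
  obtain s5 where s5: "t\<^sub>0 \<le> s5" "\<And>t r. s5 \<le> t \<Longrightarrow> t \<le> r \<Longrightarrow> - \<theta> r - - \<theta> t < e2" by metis
  define s where "s = Max {T, s1, s2, s3, s4, s5}"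
  have s: "T \<le> s" "s1 \<le> s" "s2 \<le> s" "s3 \<le> s" "s4 \<le> s" "s5 \<le> s" by (auto simp: s_def)
  show thesis
  proof (rule that[of s])
    show "t\<^sub>0 \<le> s" using s T by simp
    fix t r assume tr: "s \<le> t" "t \<le> r"
    then have t: "t\<^sub>0 \<le> t" "0 \<le> t" "0 \<le> r" "T \<le> t" "T \<le> r" "s1 \<le> t" "s2 \<le> t" "s3 \<le> t" "s3 \<le> r" "s4 \<le> t" "s5 \<le> t"
      using s T t\<^sub>0 by auto
    define Q where "Q q = p q + inner (x q) (x r) - 3/2 * (norm (x r))\<^sup>2" for q
    have "Y r c' r - Y r c' t \<le> integral {t..r} (\<lambda>q. (2 * M + 3) * (D q + G q))"
    proof (rule increment[OF _ t(1) tr(2)])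
      have "Y r c' = (\<lambda>t. A t * inner (y t) (x t + x r) + \<theta> t * (p t + inner (x t) (x r) - 3/2 * (norm (x r))\<^sup>2 + c')
          + 1 / (1 + \<alpha>) * (w t * A t * (E t - E r)))" by (simp add: Y_def[abs_def])
      then show "ac_on t r (Y r c')"
        using t(2) by (simp only:) (intro ac_on_add ac_on_diff ac_on_mult ac_on_inner ac_on_const ac ac_weights ac_E ac_p)
      show "(\<lambda>q. (2 * M + 3) * (D q + G q)) integrable_on {t..r}"
        using t(2) by (intro integrable_add integrable_on_mult_right G_integrable_on D_integrable_on)
      fix q assume q: "t < q" "q < r" "regular q"
      then show "\<exists>d\<le>(2 * M + 3) * (D q + G q). (Y r c' has_real_derivative d) (at q)"
        unfolding c'_def using t M by (intro Y_deriv) auto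
    qed
    also have "\<dots> = (2 * M + 3) * (integral {t..r} D + integral {t..r} G)"
      using G_integrable_on[OF t(2), of r] D_integrable_on[OF t(2), of r]
      by (simp add: Henstock_Kurzweil_Integration.integral_add)
    also have "\<dots> \<le> (2 * M + 3) * (e1 + e1)"
      using s1(2)[OF t(6) tr(2)] s2(2)[OF t(7) tr(2)] M0 by (intro mult_left_mono) auto
    finally have 1: "Y r c' r - Y r c' t \<le> (2 * M + 3) * (e1 + e1)" .
    have Ay: "\<bar>A q * inner (y q) (x q + x r)\<bar> \<le> e1 * (2 * M)" if q: "t \<le> q" for q
    proof -
      have q0: "0 \<le> q" "T \<le> q" "s3 \<le> q" using q t by auto
      have "norm (x q + x r) \<le> 2 * M" using M[of q] M[of r] q0 t norm_triangle_ineq[of "x q" "x r"] by simp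
      have "\<bar>A q * inner (y q) (x q + x r)\<bar> \<le> A q * (norm (y q) * norm (x q + x r))"
        using weights[OF q0(1)] by (simp add: abs_mult Cauchy_Schwarz_ineq2 mult_left_mono)
      also have "\<dots> = A q * norm (y q) * norm (x q + x r)" by simp
      also have "\<dots> \<le> e1 * (2 * M)"
        using s3(2)[OF q0(3)] e1 \<open>norm (x q + x r) \<le> 2 * M\<close> by (intro mult_mono) auto
      finally show ?thesis .
    qed
    have "Q r = 0" by (simp add: Q_def p_def power2_norm_eq_inner)
    then have "Y r c' r = A r * inner (y r) (x r + x r) + \<theta> r * c'" unfolding Y_def Q_def by simp
    moreover have "1 / (1 + \<alpha>) * (w t * A t * (E t - E r)) \<le> K * e / 8"
    proof -
      have "1 / (1 + \<alpha>) * (w t * A t * (E t - E r)) \<le> 1 / (1 + \<alpha>) * (w t * A t * E t)"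
        using \<alpha> weights[OF t(2)] E_nonneg[of r] by (intro mult_left_mono) auto
      also have "\<dots> \<le> 1 * (w t * A t * E t)"
        using \<alpha> weights[OF t(2)] E_nonneg[of t] by (intro mult_right_mono) auto
      finally show ?thesis using s4(2)[OF t(10)] unfolding V_def by linarith
    qed
    moreover have "(\<theta> t - \<theta> r) * c' \<le> K * e / 8"
    proof -
      have "(\<theta> t - \<theta> r) * c' \<le> e2 * (c' + 1)"
        using s5(2)[OF t(11) tr(2)] e2 c' by (intro mult_mono) auto
      also have "\<dots> = K * e / 8" using cancel[of "c' + 1" "K * e"] c' unfolding e2_def by linarith
      finally show ?thesis .
    qed
    moreover have "Y r c' t = A t * inner (y t) (x t + x r) + (\<theta> t * Q t + \<theta> t * c')
        + 1 / (1 + \<alpha>) * (w t * A t * (E t - E r))"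
      unfolding Y_def Q_def by (simp add: distrib_left)
    moreover have "e1 * (2 * M + 3) = K * e / 8"
      using cancel[of "2 * M + 3" "K * e"] M0 unfolding e1_def by linarith
    moreover have "(2 * M + 3) * (e1 + e1) = 2 * (e1 * (2 * M + 3))" by (simp add: algebra_simps)
    moreover have "e1 * (2 * M) \<le> e1 * (2 * M + 3)" using e1 by (intro mult_left_mono) auto
    ultimately have "- (\<theta> t * Q t) \<le> K * e"
      using 1 abs_le_D1[OF Ay[of t]] abs_le_D2[OF Ay[OF tr(2)]] mult_pos_pos[OF K e]
      unfolding left_diff_distrib[of "\<theta> t"] by linarith
    \<comment> \<open>Only \<open>Q t \<le> 0\<close> needs the lower bound on \<theta>; otherwise
      \<open>- Q t\<close> is negative and the goal is immediate.\<close>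
    moreover have "K * - Q t \<le> \<theta> t * - Q t" if "Q t \<le> 0"
      using that \<theta>_ge[OF t(1)] by (intro mult_right_mono) auto
    ultimately have "K * - Q t \<le> K * e" using K e by (cases "Q t \<le> 0") (auto intro: order_trans[OF _ less_imp_le[OF mult_pos_pos]])
    then have "- Q t \<le> e" using mult_le_cancel_left_pos[OF K, of "- Q t" e] by blast
    moreover have "(norm (x r))\<^sup>2 - (norm (x t))\<^sup>2 + (norm (x t - x r))\<^sup>2 / 2 = - Q t"
      by (simp add: Q_def p_def power2_norm_eq_inner inner_diff_left inner_diff_right inner_commute[of "x r" "x t"])
         (simp add: field_simps)
    ultimately show "(norm (x r))\<^sup>2 - (norm (x t))\<^sup>2 + (norm (x t - x r))\<^sup>2 / 2 \<le> e" by simp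
  qed
qed

text \<open>By \<open>norm_x_increment\<close> the squared norm is almost nonincreasing, so beyond a
  time where it is near its infimum \<open>L\<close> it stays within \<open>2 * \<eta>\<close> of
  \<open>L\<close>. The same inequality then bounds half the squared distance by
  \<open>3 * \<eta>\<close>.\<close>

lemma x_Cauchy:
  assumes e: "0 < e"
  obtains s where "t\<^sub>0 \<le> s" "\<And>t r. s \<le> t \<Longrightarrow> s \<le> r \<Longrightarrow> norm (x t - x r) < e"
proof -
  define \<eta> where "\<eta> = e\<^sup>2 / 12"
  have \<eta>: "0 < \<eta>" using e by (simp add: \<eta>_def)
  obtain s1 where s1: "t\<^sub>0 \<le> s1"
    "\<And>t r. s1 \<le> t \<Longrightarrow> t \<le> r \<Longrightarrow> (norm (x r))\<^sup>2 - (norm (x t))\<^sup>2 + (norm (x t - x r))\<^sup>2 / 2 \<le> \<eta>"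
    using norm_x_increment[OF \<eta>] by blast
  define L where "L = (INF t\<in>{s1..}. (norm (x t))\<^sup>2)"
  have bdd: "bdd_below ((\<lambda>t. (norm (x t))\<^sup>2) ` {s1..})" by (intro bdd_belowI2[where m = 0]) auto
  have "L < L + \<eta>" using \<eta> by simp
  then obtain s where s: "s1 \<le> s" "(norm (x s))\<^sup>2 < L + \<eta>"
    unfolding L_def using cINF_less_iff[OF _ bdd] by (metis atLeast_iff empty_iff order_refl)
  have close: "norm (x t - x r) < e" if t: "s \<le> t" "t \<le> r" for t r
  proof -
    have "L \<le> (norm (x r))\<^sup>2" unfolding L_def using s t by (intro cINF_lower bdd) auto
    moreover have "(norm (x t))\<^sup>2 - (norm (x s))\<^sup>2 \<le> \<eta>"
      using s1(2)[OF s(1) t(1)] zero_le_power2[of "norm (x s - x t)"] by linarith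
    moreover have "(norm (x r))\<^sup>2 - (norm (x t))\<^sup>2 + (norm (x t - x r))\<^sup>2 / 2 \<le> \<eta>" using s1(2) s t by auto
    ultimately have "(norm (x t - x r))\<^sup>2 < 6 * \<eta>" using s(2) by linarith
    also have "\<dots> < e\<^sup>2" using e by (simp add: \<eta>_def)
    finally show ?thesis using e by (simp add: power_less_imp_less_base)
  qed
  show thesis
  proof (rule that[of s])
    show "t\<^sub>0 \<le> s" using s s1 by simp
    fix t r assume "s \<le> t" "s \<le> r"
    then show "norm (x t - x r) < e" using close[of t r] close[of r t] by (cases "t \<le> r") (auto simp: norm_minus_commute)
  qed
qed

lemma \<phi>_small:
  assumes "0 < e"
  obtains s where "t\<^sub>0 \<le> s" "\<And>t. s \<le> t \<Longrightarrow> \<phi> t < e"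
proof -
  obtain s where s: "t\<^sub>0 \<le> s" "\<And>t. s \<le> t \<Longrightarrow> V t < e" using V_small[OF assms] by blast
  have "\<phi> t < e" if t: "s \<le> t" for t
  proof -
    have t0: "0 \<le> t" using s t t\<^sub>0 by simp
    have "1 \<le> A t" using t0 \<alpha> by (simp add: A_def ge_one_powr_ge_zero)
    then have "1 * 1 \<le> w t * A t" using weights(1)[OF t0] by (intro mult_mono) auto
    then have "1 * E t \<le> w t * A t * E t" using E_nonneg by (intro mult_right_mono) auto
    moreover have "\<phi> t \<le> E t" by (simp add: E_def)
    ultimately show ?thesis using s(2)[OF t] unfolding V_def by linarith
  qed
  with s(1) that show thesis by blast
qed

end

section \<open>The potential and strong convergence\<close>

lemma integrable_on_atLeast_of_nn_integral:
  fixes f :: "real \<Rightarrow> real"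
  assumes "f \<in> borel_measurable (lebesgue_on {a..})" "\<And>t. a \<le> t \<Longrightarrow> 0 \<le> f t"
    and "(\<integral>\<^sup>+t\<in>{a..}. ennreal (f t) \<partial>lebesgue) < \<infinity>"
  shows "f integrable_on {a..}"
proof (rule integrable_on_lebesgue_on)
  have "(\<integral>\<^sup>+t. ennreal (norm (f t)) \<partial>(lebesgue_on {a..})) = (\<integral>\<^sup>+t. ennreal (norm (f t)) * indicator {a..} t \<partial>lebesgue)"
    by (rule nn_integral_restrict_space) simp
  also have "\<dots> = (\<integral>\<^sup>+t\<in>{a..}. ennreal (f t) \<partial>lebesgue)"
    using assms(2) by (intro nn_integral_cong) (auto simp: indicator_def)
  finally show "integrable (lebesgue_on {a..}) f"
    using assms(1,3) by (intro integrableI_bounded) auto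
qed auto

lemma powr_shift_integrable:
  assumes "r < (-1::real)"
  shows "(\<lambda>t. (1 + t) powr r) integrable_on {0..}"
proof (rule integrable_on_atLeast_of_nn_integral)
  have "((\<lambda>t. (1 + t) powr (r + 1) / (r + 1)) \<longlongrightarrow> 0 / (r + 1)) at_top"
    using assms
    by (intro tendsto_divide tendsto_const tendsto_neg_powr filterlim_tendsto_add_at_top[OF tendsto_const] filterlim_ident) auto
  then have lim: "((\<lambda>t. (1 + t) powr (r + 1) / (r + 1)) \<longlongrightarrow> 0) at_top" by simp
  have "(\<integral>\<^sup>+t. ennreal ((1 + t) powr r) * indicator {0..} t \<partial>lborel) = ennreal (0 - (1 + 0) powr (r + 1) / (r + 1))"
    using assms by (intro nn_integral_FTC_atLeast lim) (auto intro!: derivative_eq_intros)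
  then show "(\<integral>\<^sup>+t\<in>{0..}. ennreal ((1 + t) powr r) \<partial>lebesgue) < \<infinity>"
    by (simp add: nn_integral_completion)
  show "(\<lambda>t. (1 + t) powr r) \<in> borel_measurable (lebesgue_on {0..})"
    by (intro measurable_restrict_space1 measurable_completion) simp
qed auto

section \<open>Convexity inequalities for the potential\<close>

text \<open>Restriction to the line through \<open>v\<close> and \<open>w\<close> reduces the claim
  to a convex function of one real variable.\<close>

lemma convex_on_ge_tangent:
  fixes F :: "'v::real_normed_vector \<Rightarrow> real"
  assumes F: "convex_on UNIV F" and deriv: "(F has_derivative F') (at v)"
  shows "F v + F' (w - v) \<le> F w"
proof -
  define h where "h t = F (v + t *\<^sub>R (w - v))" for t :: real
  have "convex_on UNIV h"
  proof (rule convex_onI)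
    fix t a b :: real assume t: "0 < t" "t < 1"
    have "v + ((1 - t) *\<^sub>R a + t *\<^sub>R b) *\<^sub>R (w - v)
        = (1 - t) *\<^sub>R (v + a *\<^sub>R (w - v)) + t *\<^sub>R (v + b *\<^sub>R (w - v))"
      by (simp add: algebra_simps)
    then show "h ((1 - t) *\<^sub>R a + t *\<^sub>R b) \<le> (1 - t) * h a + t * h b"
      unfolding h_def using convex_onD[OF F, of t] t by simp
  qed simp
  moreover have "(h has_real_derivative F' (w - v)) (at 0)"
  proof -
    have "((\<lambda>t. v + t *\<^sub>R (w - v)) has_derivative (\<lambda>t. t *\<^sub>R (w - v))) (at 0)"
      by (auto intro!: derivative_eq_intros)
    from has_derivative_compose[OF this, of F F'] deriv
    have "(h has_derivative (\<lambda>t. F' (t *\<^sub>R (w - v)))) (at 0)"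
      by (simp add: h_def[abs_def])
    then show ?thesis
      by (rule has_derivative_imp_has_field_derivative)
        (simp add: linear_scale[OF has_derivative_linear[OF deriv]])
  qed
  ultimately have "F' (w - v) * (1 - 0) \<le> h 1 - h 0"
    by (intro convex_on_imp_above_tangent[where A = UNIV]) auto
  then show ?thesis by (simp add: h_def)
qed

lemma potential_has_derivative:
  assumes sym: "\<And>v w. blinfun_apply (blinfun_apply A v) w = blinfun_apply (blinfun_apply A w) v"
    and F: "(F has_derivative blinfun_apply f') (at v)"
  shows "(potential A F has_derivative blinfun_apply (blinfun_apply A v + f')) (at v)"
proof -
  have "((\<lambda>v. blinfun_apply (blinfun_apply A v) v) has_derivative
      (\<lambda>h. blinfun_apply (blinfun_apply A v) h + blinfun_apply (blinfun_apply A h) v)) (at v)"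
    by (rule blinfun.FDERIV[OF bounded_linear_imp_has_derivative[OF blinfun.bounded_linear_right] has_derivative_ident])
  from has_derivative_add[OF has_derivative_mult_right[OF this, of "1/2"] F]
  show ?thesis
    unfolding potential_def[abs_def]
  proof (rule has_derivative_eq_rhs, intro ext)
    fix h
    show "1/2 * (blinfun_apply (blinfun_apply A v) h + blinfun_apply (blinfun_apply A h) v) + blinfun_apply f' h
        = blinfun_apply (blinfun_apply A v + f') h"
      unfolding sym[of h v] by (simp add: blinfun.add_left)
  qed
qed

text \<open>The quadratic part exceeds its tangent by half of the form at \<open>w - v\<close>,
  which is nonnegative; the rest is the tangent inequality of \<open>F\<close>.\<close>

lemma potential_ge_tangent:
  assumes sym: "\<And>v w. blinfun_apply (blinfun_apply A v) w = blinfun_apply (blinfun_apply A w) v"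
    and pos: "\<And>v. 0 \<le> blinfun_apply (blinfun_apply A v) v"
    and F: "convex_on UNIV F" "(F has_derivative blinfun_apply f') (at v)"
  shows "potential A F v + blinfun_apply (blinfun_apply A v + f') (w - v) \<le> potential A F w"
  using convex_on_ge_tangent[OF F, of w] pos[of "w - v"] sym[of v w]
  by (simp add: potential_def blinfun.diff_left blinfun.diff_right blinfun.add_left)

text \<open>For the quadratic part this is the parallelogram identity with equality; convexity gives
  the correct sign for \<open>F\<close>. Near the minimum, small potentials thus force a small
  energy seminorm of the difference.\<close>

lemma potential_midpoint:
  assumes sym: "\<And>v w. blinfun_apply (blinfun_apply A v) w = blinfun_apply (blinfun_apply A w) v"
    and F: "convex_on UNIV F"
  shows "blinfun_apply (blinfun_apply A (v - w)) (v - w)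
    \<le> 4 * (potential A F v + potential A F w - 2 * potential A F ((1/2) *\<^sub>R (v + w)))"
proof -
  define m where "m = (1/2) *\<^sub>R (v + w)"
  have "F m \<le> 1/2 * F v + 1/2 * F w"
    using convex_onD[OF F, of "1/2" v w] by (simp add: m_def scaleR_right_distrib)
  moreover have "blinfun_apply (blinfun_apply A m) m
      = 1/4 * (blinfun_apply (blinfun_apply A v) v + 2 * blinfun_apply (blinfun_apply A v) w
          + blinfun_apply (blinfun_apply A w) w)"
    using sym[of v w]
    by (simp add: m_def blinfun.add_left blinfun.add_right blinfun.scaleR_left blinfun.scaleR_right add_divide_distrib)
  moreover have "blinfun_apply (blinfun_apply A (v - w)) (v - w)
      = blinfun_apply (blinfun_apply A v) v - 2 * blinfun_apply (blinfun_apply A v) w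
          + blinfun_apply (blinfun_apply A w) w"
    using sym[of v w] by (simp add: blinfun.diff_left blinfun.diff_right)
  ultimately show ?thesis unfolding potential_def m_def[symmetric]
    by (simp add: algebra_simps)
qed

section \<open>Reduction to the flow in \<open>H\<close> and convergence in \<open>V\<close>\<close>

theorem theorem1p3:
  fixes j :: "'v::{real_inner, complete_space} \<Rightarrow>\<^sub>L 'h::{real_inner, complete_space}"
    and A :: "'v \<Rightarrow>\<^sub>L 'v \<Rightarrow>\<^sub>L real"
    and f :: "'v \<Rightarrow> ('v \<Rightarrow>\<^sub>L real)"
    and F :: "'v \<Rightarrow> real"
    and \<alpha> K t\<^sub>0 lam \<mu> :: real
    and \<gamma> \<delta> :: "real \<Rightarrow> real"
    and g u' u'' :: "real \<Rightarrow> 'h"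
    and u :: "real \<Rightarrow> 'v"
  assumes embedding: "inj (blinfun_apply j)" "closure (range (blinfun_apply j)) = UNIV"
    and \<alpha>: "0 \<le> \<alpha>" "\<alpha> < 1"
    and \<gamma>_regular: "W11_loc \<gamma>" "\<And>t. t \<ge> 0 \<Longrightarrow> \<gamma> t \<ge> 0"
    and \<gamma>_lower: "K > 0" "t\<^sub>0 \<ge> 0" "\<And>t. t \<ge> t\<^sub>0 \<Longrightarrow> \<gamma> t \<ge> K / (1 + t) powr \<alpha>"
    and \<gamma>_decay: "has_weak_derivative (\<lambda>t. (1 + t) powr \<alpha> * \<gamma> t) \<delta>"
      "AE t in lebesgue. t \<ge> t\<^sub>0 \<longrightarrow> \<delta> t \<le> 0"
    and A_symmetric: "\<And>v w. blinfun_apply (blinfun_apply A v) w = blinfun_apply (blinfun_apply A w) v"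
    and A_positive: "\<And>v. blinfun_apply (blinfun_apply A v) v \<ge> 0"
    and A_coercive: "lam \<ge> 0" "\<mu> > 0"
      "\<And>v. blinfun_apply (blinfun_apply A v) v + lam * (norm (blinfun_apply j v))\<^sup>2 \<ge> \<mu> * (norm v)\<^sup>2"
    and f_continuous: "continuous_on UNIV f"
    and F_convex: "convex_on UNIV F"
    and F_derivative: "\<And>v. (F has_derivative blinfun_apply (f v)) (at v)"
    and argmin_nonempty: "arg_min_set (potential A F) \<noteq> {}"
    and g_integrable: "strongly_integrable (lebesgue_on {0..}) g"
    and even: "\<And>v. potential A F (- v) = potential A F v"
    and g_weighted:
      "(\<integral>\<^sup>+t\<in>{0..}. ennreal ((1 + t) powr \<alpha> * norm (g t)) \<partial>lebesgue) < \<infinity>"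
      "(\<integral>\<^sup>+t\<in>{0..}. ennreal ((1 + t) powr (2 * \<alpha> + 1) * (norm (g t))\<^sup>2) \<partial>lebesgue) < \<infinity>"
    and u_W21_H: "has_weak_derivative (\<lambda>t. blinfun_apply j (u t)) u'" "has_weak_derivative u' u''"
    and u_W11_V: "W11_loc u"
    and equation: "AE t in lebesgue. t \<ge> 0 \<longrightarrow>
      dual_embed j (u'' t) + \<gamma> t *\<^sub>R dual_embed j (u' t) + blinfun_apply A (u t) + f (u t)
        = dual_embed j (g t)"
  shows "\<exists>u_inf \<in> arg_min_set (potential A F). (u \<longlongrightarrow> u_inf) at_top"
proof -
  obtain v' where v': "has_weak_derivative u v'" using u_W11_V by (auto simp: W11_loc_def)
  define \<Phi> where "\<Phi> = potential A F"
  define d\<Phi> where "d\<Phi> v = blinfun_apply A v + f v" for v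
  note \<Phi>_deriv = potential_has_derivative[OF A_symmetric F_derivative, folded \<Phi>_def d\<Phi>_def]
  note \<Phi>_tangent = potential_ge_tangent[OF A_symmetric A_positive F_convex F_derivative, folded \<Phi>_def d\<Phi>_def]
  have \<Phi>_even: "\<Phi> (- v) = \<Phi> v" for v using even by (simp add: \<Phi>_def)
  \<comment> \<open>Adding the tangent inequalities at 0 towards \<open>v\<close> and
    \<open>- v\<close> removes the linear term.\<close>
  have \<Phi>_min: "\<Phi> 0 \<le> \<Phi> v" for v
    using \<Phi>_tangent[of 0 v] \<Phi>_tangent[of 0 "- v"] \<Phi>_even[of v] by (simp add: blinfun.minus_right)
  define x where "x t = blinfun_apply j (u t)" for t
  define \<theta> where "\<theta> t = (1 + t) powr \<alpha> * \<gamma> t" for t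
  define \<phi> where "\<phi> t = \<Phi> (u t) - \<Phi> 0" for t
  have x_weak: "has_weak_derivative x u'" using u_W21_H(1) by (simp add: x_def[abs_def])
  have \<theta>_weak: "has_weak_derivative \<theta> \<delta>" using \<gamma>_decay(1) by (simp add: \<theta>_def[abs_def])
  have ac_\<phi>: "ac_on a b \<phi>" if a: "0 \<le> a" for a b
  proof -
    have ac_u: "ac_on a b u" by (rule ac_on_weak_derivative[OF v' a])
    have "continuous_on {a..b} (\<lambda>t. d\<Phi> (u t))"
      unfolding d\<Phi>_def
      by (intro continuous_intros ac_on_continuous[OF ac_u] continuous_on_compose2[OF f_continuous]) auto
    then have "bounded ((\<lambda>t. d\<Phi> (u t)) ` {a..b})"
      by (intro compact_imp_bounded compact_continuous_image) auto
    then obtain R where R: "\<And>t. t \<in> {a..b} \<Longrightarrow> norm (d\<Phi> (u t)) \<le> R" unfolding bounded_iff by blast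
    \<comment> \<open>The tangent inequality at \<open>u t\<close> makes the potential Lipschitz
      along the path, since the gradient is bounded on its compact image; exchanging
      \<open>s\<close> and \<open>t\<close> gives the absolute value.\<close>
    have le: "\<Phi> (u t) - \<Phi> (u s) \<le> R * norm (u t - u s)" if "t \<in> {a..b}" for s t
    proof -
      have "\<Phi> (u t) - \<Phi> (u s) \<le> blinfun_apply (d\<Phi> (u t)) (u t - u s)"
        using \<Phi>_tangent[of "u t" "u s"] by (simp add: blinfun.diff_right)
      also have "\<dots> \<le> norm (d\<Phi> (u t)) * norm (u t - u s)"
        using norm_blinfun[of "d\<Phi> (u t)" "u t - u s"] by simp
      also have "\<dots> \<le> R * norm (u t - u s)" using R[OF that] by (intro mult_right_mono) auto
      finally show ?thesis .
    qed
    show ?thesis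
    proof (rule ac_on_combine[OF ac_u ac_on_const[of _ _ "0::real"], of _ R])
      fix s t assume "s \<in> {a..b}" "t \<in> {a..b}"
      then show "norm (\<phi> t - \<phi> s) \<le> R * (norm (u t - u s) + norm (0 - 0 :: real))"
        using le[of t s] le[of s t] by (simp add: \<phi>_def norm_minus_commute abs_le_iff)
    qed
  qed
  have derivs: "AE t in lebesgue. t\<^sub>0 < t \<longrightarrow> (x has_vector_derivative u' t) (at t) \<and>
      (u' has_vector_derivative u'' t) (at t) \<and> (\<theta> has_real_derivative \<delta> t) (at t) \<and> \<delta> t \<le> 0"
    using weak_derivative_has_vector_derivative[OF x_weak] weak_derivative_has_vector_derivative[OF u_W21_H(2)]
      weak_derivative_has_vector_derivative[OF \<theta>_weak] \<gamma>_decay(2)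
    by eventually_elim (use \<gamma>_lower(2) in \<open>auto simp: has_real_derivative_iff_has_vector_derivative\<close>)
  have flow: "AE t in lebesgue. t\<^sub>0 < t \<longrightarrow>
      (\<phi> has_real_derivative - inner (u'' t + \<gamma> t *\<^sub>R u' t - g t) (u' t)) (at t) \<and>
      inner (u'' t + \<gamma> t *\<^sub>R u' t - g t) (x t) \<le> - \<phi> t \<and>
      (\<forall>s\<ge>0. inner (u'' t + \<gamma> t *\<^sub>R u' t - g t) (x t + x s) \<le> \<phi> s - \<phi> t)"
    using derivs equation weak_derivative_has_vector_derivative[OF v']
  proof eventually_elim
    case (elim t)
    show ?case
    proof
      assume "t\<^sub>0 < t"
      with elim \<gamma>_lower(2) have dx: "(x has_vector_derivative u' t) (at t)" and du: "(u has_vector_derivative v' t) (at t)"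
        and eq: "dual_embed j (u'' t) + \<gamma> t *\<^sub>R dual_embed j (u' t) + blinfun_apply A (u t) + f (u t)
          = dual_embed j (g t)" by auto
      \<comment> \<open>The derivative in \<open>V\<close> is carried into \<open>H\<close> by
        \<open>j\<close>; uniqueness of derivatives identifies its image with \<open>u' t\<close>.
        Hence the equation can be paired with the velocity.\<close>
      have "(x has_vector_derivative blinfun_apply j (v' t)) (at t)"
        unfolding x_def[abs_def] by (rule bounded_linear.has_vector_derivative[OF blinfun.bounded_linear_right du])
      with dx have jv': "blinfun_apply j (v' t) = u' t" by (metis vector_derivative_unique_at)
      have pairing: "inner (u'' t + \<gamma> t *\<^sub>R u' t - g t) (blinfun_apply j h) = - blinfun_apply (d\<Phi> (u t)) h" for h
        using arg_cong[OF eq, of "\<lambda>l. blinfun_apply l h"]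
        by (simp add: dual_embed_apply d\<Phi>_def blinfun.add_left blinfun.scaleR_left inner_add_left inner_diff_left)
      have "((\<lambda>t. \<Phi> (u t)) has_vector_derivative blinfun_apply (d\<Phi> (u t)) (v' t)) (at t)"
        using has_derivative_compose[OF du[unfolded has_vector_derivative_def] \<Phi>_deriv]
        by (simp add: has_vector_derivative_def blinfun.scaleR_right)
      then have "(\<phi> has_real_derivative blinfun_apply (d\<Phi> (u t)) (v' t)) (at t)"
        unfolding \<phi>_def[abs_def] has_real_derivative_iff_has_vector_derivative
        by (auto intro!: derivative_eq_intros)
      then have "(\<phi> has_real_derivative - inner (u'' t + \<gamma> t *\<^sub>R u' t - g t) (u' t)) (at t)"
        using pairing[of "v' t"] jv' by simp
      moreover have "inner (u'' t + \<gamma> t *\<^sub>R u' t - g t) (x t) \<le> - \<phi> t"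
        using pairing[of "u t"] \<Phi>_tangent[of "u t" 0] by (simp add: x_def \<phi>_def blinfun.minus_right)
      \<comment> \<open>Evenness enters here: the tangent inequality at \<open>u t\<close> is tested
        at \<open>- u s\<close>, whose potential equals that of \<open>u s\<close>.\<close>
      moreover have "inner (u'' t + \<gamma> t *\<^sub>R u' t - g t) (x t + x s) \<le> \<phi> s - \<phi> t" for s
        using pairing[of "u t + u s"] \<Phi>_tangent[of "u t" "- u s"] \<Phi>_even[of "u s"]
        by (simp add: x_def \<phi>_def blinfun.add_right blinfun.diff_right blinfun.minus_right)
      ultimately show "(\<phi> has_real_derivative - inner (u'' t + \<gamma> t *\<^sub>R u' t - g t) (u' t)) (at t) \<and>
        inner (u'' t + \<gamma> t *\<^sub>R u' t - g t) (x t) \<le> - \<phi> t \<and>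
        (\<forall>s\<ge>0. inner (u'' t + \<gamma> t *\<^sub>R u' t - g t) (x t + x s) \<le> \<phi> s - \<phi> t)" by blast
    qed
  qed
  have g_meas: "g \<in> borel_measurable (lebesgue_on {0..})"
    using g_integrable by (auto simp: strongly_integrable_def has_strong_integral_def)
  have norm_g: "(\<lambda>t. norm (g t)) \<in> borel_measurable (lebesgue_on {0..})"
    by (rule borel_measurable_continuous_on[OF _ g_meas]) (intro continuous_intros)
  have powr_meas: "(\<lambda>t. (1 + t) powr r) \<in> borel_measurable (lebesgue_on {0..})" for r :: real
    by (intro measurable_restrict_space1 measurable_completion) simp
  have source: "(\<lambda>t. (1 + t) powr \<alpha> * norm (g t) + (1 + t) powr (2 * \<alpha> + 1) * (norm (g t))\<^sup>2
      + (1 + t) powr (\<alpha> - 2)) integrable_on {0..}"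
    using g_weighted \<alpha> norm_g powr_meas
    by (intro integrable_add integrable_on_atLeast_of_nn_integral powr_shift_integrable
        borel_measurable_times borel_measurable_power) auto
  interpret even_damped_flow \<alpha> K t\<^sub>0 \<gamma> \<theta> \<delta> \<phi> g x u' u''
  proof
    show "K \<le> \<theta> t" if "t\<^sub>0 \<le> t" for t
    proof -
      have "0 < (1 + t) powr \<alpha>" using that \<gamma>_lower(2) by simp
      then show ?thesis using \<gamma>_lower(3)[OF that] by (simp add: \<theta>_def divide_le_eq mult.commute)
    qed
    show "0 \<le> \<phi> t" for t using \<Phi>_min by (simp add: \<phi>_def)
  qed (use \<alpha> \<gamma>_lower ac_\<phi> ac_on_weak_derivative x_weak u_W21_H(2) \<theta>_weak derivs flow source in \<open>auto simp: \<theta>_def\<close>)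
  have tail: "\<exists>s. \<forall>t r. s \<le> t \<longrightarrow> s \<le> r \<longrightarrow> norm (u t - u r) < e" if e: "0 < e" for e
  proof -
    \<comment> \<open>Coercivity gets half of \<open>\<mu> * e\<^sup>2\<close> from the form and
      half from the \<open>H\<close> norm. \<open>lam + 1\<close> replaces \<open>lam\<close> in the
      denominator so that \<open>lam = 0\<close> is covered; \<open>\<mu> * e\<^sup>2 / 16\<close>
      below matches the factor 4 of the midpoint bound and the two times.\<close>
    define e1 where "e1 = \<mu> * e\<^sup>2 / (2 * (lam + 1))"
    have e1: "0 < e1" using A_coercive e by (auto simp: e1_def intro!: divide_pos_pos)
    obtain s1 where s1: "\<And>t r. s1 \<le> t \<Longrightarrow> s1 \<le> r \<Longrightarrow> norm (x t - x r) < sqrt e1"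
      using x_Cauchy[OF real_sqrt_gt_zero[OF e1]] by metis
    have "0 < \<mu> * e\<^sup>2 / 16" using A_coercive(2) e by simp
    then obtain s2 where s2: "\<And>t. s2 \<le> t \<Longrightarrow> \<phi> t < \<mu> * e\<^sup>2 / 16"
      using \<phi>_small by metis
    have "norm (u t - u r) < e" if "max s1 s2 \<le> t" "max s1 s2 \<le> r" for t r
    proof -
      have tr: "s1 \<le> t" "s2 \<le> t" "s1 \<le> r" "s2 \<le> r" using that by auto
      have "blinfun_apply (blinfun_apply A (u t - u r)) (u t - u r) \<le> 4 * (\<phi> t + \<phi> r)"
        using potential_midpoint[OF A_symmetric F_convex, of "u t" "u r"] \<Phi>_min[of "(1/2) *\<^sub>R (u t + u r)"]
        by (simp add: \<phi>_def \<Phi>_def)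
      also have "\<dots> < \<mu> * e\<^sup>2 / 2" using s2[of t] s2[of r] tr by simp
      finally have a: "blinfun_apply (blinfun_apply A (u t - u r)) (u t - u r) < \<mu> * e\<^sup>2 / 2" .
      have "(norm (x t - x r))\<^sup>2 \<le> (sqrt e1)\<^sup>2" using s1[of t r] tr by (intro power_mono) auto
      then have "lam * (norm (blinfun_apply j (u t - u r)))\<^sup>2 \<le> (lam + 1) * e1"
        using A_coercive e1 by (intro mult_mono) (auto simp: x_def blinfun.diff_right)
      also have "\<dots> = \<mu> * e\<^sup>2 / 2"
      proof -
        have "b * (a / (2 * b)) = a / 2" if "b \<noteq> 0" for a b :: real using that by simp
        from this[of "lam + 1" "\<mu> * e\<^sup>2"] A_coercive(1) show ?thesis unfolding e1_def by linarith
      qed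
      finally have "\<mu> * (norm (u t - u r))\<^sup>2 < \<mu> * e\<^sup>2" using a A_coercive(3)[of "u t - u r"] by linarith
      then have "(norm (u t - u r))\<^sup>2 < e\<^sup>2" using A_coercive(2) by simp
      then show ?thesis using e by (simp add: power_less_imp_less_base)
    qed
    then show ?thesis by blast
  qed
  \<comment> \<open>Completeness of \<open>V\<close> yields the limit along integer times;
    \<open>tail\<close> extends it to all real times.\<close>
  have "Cauchy (\<lambda>n. u (real n))"
    unfolding Cauchy_def dist_norm
  proof (intro allI impI)
    fix e :: real assume "0 < e"
    then obtain s where "\<forall>t r. s \<le> t \<longrightarrow> s \<le> r \<longrightarrow> norm (u t - u r) < e" using tail by blast
    then show "\<exists>M. \<forall>m\<ge>M. \<forall>n\<ge>M. norm (u (real m) - u (real n)) < e"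
      by (intro exI[of _ "nat \<lceil>s\<rceil>"]) (auto simp: nat_le_iff ceiling_le_iff)
  qed
  then obtain u_inf where lim: "(\<lambda>n. u (real n)) \<longlonglongrightarrow> u_inf" 
    using Cauchy_convergent unfolding convergent_def by blast
  have "(u \<longlongrightarrow> u_inf) at_top"
  proof (rule tendstoI)
    fix e :: real assume e: "0 < e"
    obtain s where s: "\<And>t r. s \<le> t \<Longrightarrow> s \<le> r \<Longrightarrow> norm (u t - u r) < e / 2"
      using tail[OF half_gt_zero[OF e]] by metis
    have "eventually (\<lambda>n. dist (u (real n)) u_inf < e / 2 \<and> s \<le> real n) sequentially"
      using tendstoD[OF lim, of "e / 2"] e
      by (intro eventually_conj filterlim_real_sequentially[THEN filterlim_at_top[THEN iffD1], rule_format]) auto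
    then obtain n where n: "dist (u (real n)) u_inf < e / 2" "s \<le> real n" by (auto simp: eventually_sequentially)
    have "dist (u t) u_inf < e" if "s \<le> t" for t
      using s[OF that n(2)] n(1) dist_triangle[of "u t" u_inf "u (real n)"] by (simp add: dist_norm)
    then show "eventually (\<lambda>t. dist (u t) u_inf < e) at_top" by (auto simp: eventually_at_top_linorder)
  qed
  moreover have "u_inf \<in> arg_min_set (potential A F)"
  proof -
    \<comment> \<open>The potential along the solution tends both to its value at the limit, by
      continuity, and to the minimum, by \<open>\<phi>_small\<close>.\<close>
    have "isCont \<Phi> u_inf" using \<Phi>_deriv by (rule has_derivative_continuous)
    then have "((\<lambda>t. \<Phi> (u t)) \<longlongrightarrow> \<Phi> u_inf) at_top" using calculation by (rule isCont_tendsto_compose)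
    moreover have "((\<lambda>t. \<Phi> (u t)) \<longlongrightarrow> \<Phi> 0) at_top"
    proof (rule tendstoI)
      fix e :: real assume "0 < e"
      then obtain s where "\<And>t. s \<le> t \<Longrightarrow> \<phi> t < e" using \<phi>_small by metis
      then have "dist (\<Phi> (u t)) (\<Phi> 0) < e" if "s \<le> t" for t using \<phi>_nonneg[of t] that by (simp add: \<phi>_def dist_real_def)
      then show "eventually (\<lambda>t. dist (\<Phi> (u t)) (\<Phi> 0) < e) at_top" by (auto simp: eventually_at_top_linorder)
    qed
    ultimately have "\<Phi> u_inf = \<Phi> 0" by (rule tendsto_unique[OF trivial_limit_at_top_linorder])
    then show ?thesis using \<Phi>_min by (auto simp: arg_min_set_def is_arg_min_def \<Phi>_def not_less)
  qed
  ultimately show ?thesis by blast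
qed

end
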